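(* Let $\theta>0$ and $\tau_n>0$ for $n\in\mathcal N$. The distributed spectrum access algorithm induces a continuous-time Markov chain on $\Omega=\prod_{n=1}^N\mathcal M_n$: for $\boldsymbol a\neq\boldsymbol a'$ differing exactly in the choice of one user $n$ (so $\boldsymbol a=(a_n,a_{-n})$, $\boldsymbol a'=(a_n',a_{-n})$ with $a_n\ne a_n'$), the transition rate is $$q_{\boldsymbol a,\boldsymbol a'}=\frac{\tau_n}{|\mathcal M_n|}\cdot\frac{\exp(\theta S_n(a_n',a_{-n}))}{\max\{\exp(\theta S_n(a_n',a_{-n})),\exp(\theta S_n(a_n,a_{-n}))\}},$$ and $q_{\boldsymbol a,\boldsymbol a'}=0$ for all other pairs $\boldsymbol a\ne\boldsymbol a'$. This Markov chain is time-reversible and its unique stationary distribution is $$q^*_{\boldsymbol a}=\frac{\exp(\theta\Phi(\boldsymbol a))}{\sum_{\hat{\boldsymbol a}\in\Omega}\exp(\theta\Phi(\hat{\boldsymbol a}))},\qquad \boldsymbol a\in\Omega.$$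
   Context: Users: $\mathcal N=\{1,\dots,N\}$. User $n$ chooses a channel $a_n$ from a nonempty finite set $\mathcal M_n$; $\boldsymbol a\in\Omega=\prod_n\mathcal M_n$, and $a_{-n}$ denotes the choices of the others. $P_m>0$ is the transmission power of user $m$, $d_{mn}=d_{nm}>0$ is the distance between $m\ne n$, $\alpha>0$ is the path loss factor, $\omega^n_a\in\mathbb R$ is the noise power of user $n$ on channel $a$, and $I_{\{\cdot\}}$ is the indicator. Physical and social graphs on $\mathcal N$ (no loops) have neighbour sets $\mathcal N_n^p$ and $\mathcal N_n^s$; $\mathcal N_n^{sp}=\mathcal N_n^p\cap\mathcal N_n^s$; social ties have strengths $w_{nm}\in[0,1]$. Standing assumptions: equal powers ($P_n=P_m$), both graphs undirected, $w_{nm}=w_{mn}$. $U_n(\boldsymbol a)=-\sum_{m\in\mathcal N_n^p}P_m d_{mn}^{-\alpha}I_{\{a_n=a_m\}}-\omega^n_{a_n}$ and $S_n(\boldsymbol a)=U_n(\boldsymbol a)+\sum_{m\in\mathcal N_n^s}w_{nm}U_m(\boldsymbol a)$. Potential function: $$\Phi(\boldsymbol a)=-\frac12\sum_{n}\sum_{m\in\mathcal N_n^p}P_m d_{mn}^{-\alpha}I_{\{a_n=a_m\}}-\sum_n\omega^n_{a_n}-\frac12\sum_n\sum_{m\in\mathcal N_n^{sp}}w_{nm}P_m d_{mn}^{-\alpha}I_{\{a_n=a_m\}}.$$ Algorithm: each user $n$ independently and repeatedly waits an exponential time of rate $\tau_n$, then picks $a_n'\in\mathcal M_n$ uniformly at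 random and moves to it with probability $\exp(\theta S_n(a_n',a_{-n}))/\max\{\exp(\theta S_n(a_n',a_{-n})),\exp(\theta S_n(a_n,a_{-n}))\}$, otherwise staying at $a_n$. Time-reversible means that detailed balance holds with respect to the stationary distribution. *)

theory Defs
  imports "HOL-Probability.Probability"
begin

section \<open>Continuous-time Markov chains on a finite state space\<close>

text \<open>
  \<open>p t a b\<close> is the probability of moving from \<open>a\<close> to \<open>b\<close> in time \<open>t\<close>; the Markov property is
  stated through elementary conditional probabilities and the chain is homogeneous in time.
\<close>

definition markov_process ::
    "'w measure \<Rightarrow> (real \<Rightarrow> 'w \<Rightarrow> 's) \<Rightarrow> 's set \<Rightarrow> (real \<Rightarrow> 's \<Rightarrow> 's \<Rightarrow> real) \<Rightarrow> bool" where
  "markov_process \<Omega> X S p \<longleftrightarrow>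
     prob_space \<Omega> \<and>
     (\<forall>t\<ge>0. X t \<in> measurable \<Omega> (count_space S)) \<and>
     (AE \<omega> in \<Omega>. \<forall>t\<ge>0. eventually (\<lambda>s. X s \<omega> = X t \<omega>) (at_right t)) \<and>
     (\<forall>(k::nat) (s :: nat \<Rightarrow> real) (c :: nat \<Rightarrow> 's) t b.
        0 \<le> s 0 \<longrightarrow> (\<forall>i<k. s i \<le> s (Suc i)) \<longrightarrow> s k \<le> t \<longrightarrow> (\<forall>i\<le>k. c i \<in> S) \<longrightarrow> b \<in> S \<longrightarrow>
        \<P>(\<omega> in \<Omega>. \<forall>i\<le>k. X (s i) \<omega> = c i) > 0 \<longrightarrow>
        \<P>(\<omega> in \<Omega>. X t \<omega> = b \<bar> \<forall>i\<le>k. X (s i) \<omega> = c i) = p (t - s k) (c k) b)"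

text \<open>Only the off-diagonal entries of the rate matrix \<open>q\<close> matter.\<close>

definition has_jump_rates ::
    "'s set \<Rightarrow> (real \<Rightarrow> 's \<Rightarrow> 's \<Rightarrow> real) \<Rightarrow> ('s \<Rightarrow> 's \<Rightarrow> real) \<Rightarrow> bool" where
  "has_jump_rates S p q \<longleftrightarrow>
     (\<forall>a\<in>S. \<forall>b\<in>S. a \<noteq> b \<longrightarrow> ((\<lambda>h. p h a b / h) \<longlongrightarrow> q a b) (at_right 0))"

definition ctmc ::
    "'w measure \<Rightarrow> (real \<Rightarrow> 'w \<Rightarrow> 's) \<Rightarrow> 's set \<Rightarrow> (real \<Rightarrow> 's \<Rightarrow> 's \<Rightarrow> real) \<Rightarrow> ('s \<Rightarrow> 's \<Rightarrow> real) \<Rightarrow> bool"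
  where
  "ctmc \<Omega> X S p q \<longleftrightarrow> finite S \<and> markov_process \<Omega> X S p \<and> has_jump_rates S p q"

definition stationary_distribution ::
    "'s set \<Rightarrow> (real \<Rightarrow> 's \<Rightarrow> 's \<Rightarrow> real) \<Rightarrow> ('s \<Rightarrow> real) \<Rightarrow> bool" where
  "stationary_distribution S p \<pi> \<longleftrightarrow>
     (\<forall>a\<in>S. 0 \<le> \<pi> a) \<and> (\<Sum>a\<in>S. \<pi> a) = 1 \<and>
     (\<forall>t\<ge>0. \<forall>b\<in>S. (\<Sum>a\<in>S. \<pi> a * p t a b) = \<pi> b)"

definition detailed_balance :: "'s set \<Rightarrow> ('s \<Rightarrow> 's \<Rightarrow> real) \<Rightarrow> ('s \<Rightarrow> real) \<Rightarrow> bool" where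
  "detailed_balance S q \<pi> \<longleftrightarrow> (\<forall>a\<in>S. \<forall>b\<in>S. \<pi> a * q a b = \<pi> b * q b a)"

definition time_reversible ::
    "'s set \<Rightarrow> (real \<Rightarrow> 's \<Rightarrow> 's \<Rightarrow> real) \<Rightarrow> ('s \<Rightarrow> 's \<Rightarrow> real) \<Rightarrow> bool" where
  "time_reversible S p q \<longleftrightarrow> (\<exists>\<pi>. stationary_distribution S p \<pi> \<and> detailed_balance S q \<pi>)"


section \<open>Networks and the spectrum access game\<close>

record 'c network =
  num_users :: nat
  channels :: "nat \<Rightarrow> 'c set"
  tx_power :: "nat \<Rightarrow> real"
  distance :: "nat \<Rightarrow> nat \<Rightarrow> real"
  path_loss :: real
  noise :: "nat \<Rightarrow> 'c \<Rightarrow> real"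
  phys_nbrs :: "nat \<Rightarrow> nat set"
  soc_nbrs :: "nat \<Rightarrow> nat set"
  tie :: "nat \<Rightarrow> nat \<Rightarrow> real"

definition users :: "'c network \<Rightarrow> nat set" where
  "users G = {1..num_users G}"

definition profiles :: "'c network \<Rightarrow> (nat \<Rightarrow> 'c) set" where
  "profiles G = Pi\<^sub>E (users G) (channels G)"

locale spectrum_network =
  fixes G :: "'c network"
  assumes users_nonempty: "num_users G \<ge> 1"
    and channels_finite: "n \<in> users G \<Longrightarrow> finite (channels G n)"
    and channels_nonempty: "n \<in> users G \<Longrightarrow> channels G n \<noteq> {}"
    and power_pos: "n \<in> users G \<Longrightarrow> tx_power G n > 0"
    and power_equal: "\<lbrakk>n \<in> users G; m \<in> users G\<rbrakk> \<Longrightarrow> tx_power G n = tx_power G m"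
    and distance_pos: "\<lbrakk>n \<in> users G; m \<in> users G; m \<noteq> n\<rbrakk> \<Longrightarrow> distance G m n > 0"
    and distance_sym: "\<lbrakk>n \<in> users G; m \<in> users G; m \<noteq> n\<rbrakk> \<Longrightarrow> distance G m n = distance G n m"
    and path_loss_pos: "path_loss G > 0"
    and phys_nbrs_users: "n \<in> users G \<Longrightarrow> phys_nbrs G n \<subseteq> users G - {n}"
    and phys_nbrs_sym: "\<lbrakk>n \<in> users G; m \<in> users G\<rbrakk> \<Longrightarrow> m \<in> phys_nbrs G n \<longleftrightarrow> n \<in> phys_nbrs G m"
    and soc_nbrs_users: "n \<in> users G \<Longrightarrow> soc_nbrs G n \<subseteq> users G - {n}"
    and soc_nbrs_sym: "\<lbrakk>n \<in> users G; m \<in> users G\<rbrakk> \<Longrightarrow> m \<in> soc_nbrs G n \<longleftrightarrow> n \<in> soc_nbrs G m"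
    and tie_range: "\<lbrakk>n \<in> users G; m \<in> soc_nbrs G n\<rbrakk> \<Longrightarrow> 0 \<le> tie G n m \<and> tie G n m \<le> 1"
    and tie_sym: "\<lbrakk>n \<in> users G; m \<in> soc_nbrs G n\<rbrakk> \<Longrightarrow> tie G n m = tie G m n"

definition interference :: "'c network \<Rightarrow> (nat \<Rightarrow> 'c) \<Rightarrow> nat \<Rightarrow> nat \<Rightarrow> real" where
  "interference G a m n =
     tx_power G m * distance G m n powr (- path_loss G) * of_bool (a n = a m)"

definition utility :: "'c network \<Rightarrow> nat \<Rightarrow> (nat \<Rightarrow> 'c) \<Rightarrow> real" where
  "utility G n a = - (\<Sum>m\<in>phys_nbrs G n. interference G a m n) - noise G n (a n)"

definition social_utility :: "'c network \<Rightarrow> nat \<Rightarrow> (nat \<Rightarrow> 'c) \<Rightarrow> real" where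
  "social_utility G n a = utility G n a + (\<Sum>m\<in>soc_nbrs G n. tie G n m * utility G m a)"

definition potential :: "'c network \<Rightarrow> (nat \<Rightarrow> 'c) \<Rightarrow> real" where
  "potential G a =
     - (1/2) * (\<Sum>n\<in>users G. \<Sum>m\<in>phys_nbrs G n. interference G a m n)
     - (\<Sum>n\<in>users G. noise G n (a n))
     - (1/2) * (\<Sum>n\<in>users G. \<Sum>m\<in>phys_nbrs G n \<inter> soc_nbrs G n. tie G n m * interference G a m n)"


section \<open>The distributed spectrum access algorithm\<close>

definition move_prob :: "'c network \<Rightarrow> real \<Rightarrow> nat \<Rightarrow> (nat \<Rightarrow> 'c) \<Rightarrow> 'c \<Rightarrow> real" where
  "move_prob G \<theta> n a c =
     exp (\<theta> * social_utility G n (a(n := c))) /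
     max (exp (\<theta> * social_utility G n (a(n := c)))) (exp (\<theta> * social_utility G n a))"

text \<open>
  The randomness of the algorithm: for every user \<open>n\<close> and every round \<open>j\<close>, independently, a triple
  consisting of an exponential waiting time of rate \<open>\<tau> n\<close>, a uniformly chosen channel of \<open>n\<close>, and
  a uniform variable on \<open>[0,1]\<close> that decides whether the user moves.
\<close>

type_synonym 'c sample = "nat \<times> nat \<Rightarrow> real \<times> 'c \<times> real"

definition algorithm_space :: "'c network \<Rightarrow> (nat \<Rightarrow> real) \<Rightarrow> 'c sample measure" where
  "algorithm_space G \<tau> =
     Pi\<^sub>M (users G \<times> UNIV)
       (\<lambda>(n, j). density lborel (exponential_density (\<tau> n)) \<Otimes>\<^sub>M
                 (uniform_count_measure (channels G n) \<Otimes>\<^sub>M uniform_measure lborel {0..1}))"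

definition ring_time :: "'c sample \<Rightarrow> nat \<Rightarrow> nat \<Rightarrow> real" where
  "ring_time \<omega> n k = (\<Sum>j\<le>k. fst (\<omega> (n, j)))"

text \<open>
  \<open>c n\<close> counts the rounds that user \<open>n\<close> has completed. The user whose clock rings next is unique
  up to a null set; ties are broken towards the smallest index.
\<close>

definition next_user :: "'c network \<Rightarrow> 'c sample \<Rightarrow> (nat \<Rightarrow> nat) \<Rightarrow> nat" where
  "next_user G \<omega> c =
     (LEAST n. n \<in> users G \<and> (\<forall>m\<in>users G. ring_time \<omega> n (c n) \<le> ring_time \<omega> m (c m)))"

definition update_choice ::
    "'c network \<Rightarrow> real \<Rightarrow> nat \<Rightarrow> 'c \<times> real \<Rightarrow> (nat \<Rightarrow> 'c) \<Rightarrow> nat \<Rightarrow> 'c" where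
  "update_choice G \<theta> n = (\<lambda>(c, u) a. if u \<le> move_prob G \<theta> n a c then a(n := c) else a)"

text \<open>Channel choices and completed rounds after the first \<open>i\<close> rings, starting from \<open>a\<close>.\<close>

primrec run ::
    "'c network \<Rightarrow> real \<Rightarrow> (nat \<Rightarrow> 'c) \<Rightarrow> 'c sample \<Rightarrow> nat \<Rightarrow> (nat \<Rightarrow> 'c) \<times> (nat \<Rightarrow> nat)" where
  "run G \<theta> a \<omega> 0 = (a, \<lambda>_. 0)"
| "run G \<theta> a \<omega> (Suc i) =
     (let (b, c) = run G \<theta> a \<omega> i; n = next_user G \<omega> c
      in (update_choice G \<theta> n (snd (\<omega> (n, c n))) b, c(n := Suc (c n))))"

text \<open>The time of the ring that leads from \<open>run G \<theta> a \<omega> i\<close> to \<open>run G \<theta> a \<omega> (Suc i)\<close>.\<close>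

definition event_time :: "'c network \<Rightarrow> real \<Rightarrow> (nat \<Rightarrow> 'c) \<Rightarrow> 'c sample \<Rightarrow> nat \<Rightarrow> real" where
  "event_time G \<theta> a \<omega> i =
     (let c = snd (run G \<theta> a \<omega> i); n = next_user G \<omega> c in ring_time \<omega> n (c n))"

text \<open>
  The channel choices at time \<open>t\<close>. Almost surely the event times tend to infinity, so that the
  \<open>LEAST\<close> is taken over a nonempty set for all \<open>t\<close>.
\<close>

definition spectrum_process ::
    "'c network \<Rightarrow> real \<Rightarrow> (nat \<Rightarrow> 'c) \<Rightarrow> real \<Rightarrow> 'c sample \<Rightarrow> nat \<Rightarrow> 'c" where
  "spectrum_process G \<theta> a t \<omega> = fst (run G \<theta> a \<omega> (LEAST i. t < event_time G \<theta> a \<omega> i))"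

definition transition_prob ::
    "'c network \<Rightarrow> real \<Rightarrow> (nat \<Rightarrow> real) \<Rightarrow> real \<Rightarrow> (nat \<Rightarrow> 'c) \<Rightarrow> (nat \<Rightarrow> 'c) \<Rightarrow> real" where
  "transition_prob G \<theta> \<tau> t a b = \<P>(\<omega> in algorithm_space G \<tau>. spectrum_process G \<theta> a t \<omega> = b)"

definition transition_rate ::
    "'c network \<Rightarrow> real \<Rightarrow> (nat \<Rightarrow> real) \<Rightarrow> (nat \<Rightarrow> 'c) \<Rightarrow> (nat \<Rightarrow> 'c) \<Rightarrow> real" where
  "transition_rate G \<theta> \<tau> a b =
     (if \<exists>!n. n \<in> users G \<and> a n \<noteq> b n
      then let n = (THE n. n \<in> users G \<and> a n \<noteq> b n)
           in \<tau> n / real (card (channels G n)) *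
              (exp (\<theta> * social_utility G n (a(n := b n))) /
               max (exp (\<theta> * social_utility G n (a(n := b n)))) (exp (\<theta> * social_utility G n a)))
      else 0)"

definition gibbs :: "'c network \<Rightarrow> real \<Rightarrow> (nat \<Rightarrow> 'c) \<Rightarrow> real" where
  "gibbs G \<theta> a = exp (\<theta> * potential G a) / (\<Sum>b\<in>profiles G. exp (\<theta> * potential G b))"

end

theory Submission
  imports Defs
begin

text \<open>
  Markov property: resampling every user's clock and marks after a fixed time \<open>s\<close>, while keeping the
  rings up to \<open>s\<close>, preserves the law of the algorithm, because exponential waiting times are
  memoryless. On the resampled path the state at time \<open>s\<close> depends only on the old sample, and the
  process after \<open>s\<close> is the process driven by the new sample and started in that state. The finite
  dimensional distributions therefore factorise.

  Jump rates: the events "no ring before \<open>h\<close>" and "exactly one ring before \<open>h\<close>" give lower bounds for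
  the transition probabilities whose sum over the targets is \<open>1 - o(h)\<close>.

  Stationarity: the game is an exact potential game, so the Gibbs distribution \<open>\<pi>\<close> is in detailed
  balance with the rates. The function \<open>t \<mapsto> \<parallel>\<pi> P\<^sub>t - \<pi>\<parallel>\<^sub>1\<close> is subadditive and \<open>o(t)\<close> at \<open>0\<close>, hence
  zero. Conversely, the density of a stationary distribution with respect to \<open>\<pi>\<close> is harmonic for an
  irreducible chain, hence constant.
\<close>

section \<open>Finite Markov semigroups\<close>

text \<open>The chain is given by its clocks and not by a generator, so its law has to be read off
  the sample space. Fixing a time \<open>s\<close> cuts every clock in the middle of a waiting time,
  and the residual wait is not a coordinate of the sample. Viewing the cut as a measure preserving
  map from two independent samples to one turns independence of past and future into independence of
  the two factors of a product space; no conditional distribution is ever computed.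

  For the jump rates, the probability of two or more rings is never estimated: since the lower
  bounds nearly exhaust the total mass 1, they also bound every single entry from above.

  For stationarity, the rates give only a right derivative at time 0. Subadditivity carries this
  information to all later times and takes the place of the Kolmogorov equations. Uniqueness uses
  stationarity only through the derivative at time 0, that is, through the balance
  equations.\<close>

locale finite_semigroup =
  fixes S :: "'s set" and p :: "real \<Rightarrow> 's \<Rightarrow> 's \<Rightarrow> real" and q :: "'s \<Rightarrow> 's \<Rightarrow> real"
  assumes finite_S: "finite S"
    and p_nonneg: "\<lbrakk>0 \<le> t; a \<in> S; b \<in> S\<rbrakk> \<Longrightarrow> 0 \<le> p t a b"
    and p_sum: "\<lbrakk>0 \<le> t; a \<in> S\<rbrakk> \<Longrightarrow> (\<Sum>b\<in>S. p t a b) = 1"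
    and p_zero: "\<lbrakk>a \<in> S; b \<in> S\<rbrakk> \<Longrightarrow> p 0 a b = of_bool (a = b)"
    and p_add: "\<lbrakk>0 \<le> s; 0 \<le> t; a \<in> S; b \<in> S\<rbrakk> \<Longrightarrow> p (s + t) a b = (\<Sum>c\<in>S. p s a c * p t c b)"
    and rates: "has_jump_rates S p q"
begin

definition evolve :: "('s \<Rightarrow> real) \<Rightarrow> real \<Rightarrow> 's \<Rightarrow> real" where
  "evolve \<pi> t b = (\<Sum>a\<in>S. \<pi> a * p t a b)"

text \<open>Row sums equal to 1 express \<open>p t b b\<close> by the other entries, so that only
  off-diagonal entries remain, the ones with known rates.\<close>

lemma evolve_diff:
  assumes "0 \<le> t" "b \<in> S"
  shows "evolve \<pi> t b - \<pi> b = (\<Sum>a\<in>S - {b}. \<pi> a * p t a b - \<pi> b * p t b a)"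
proof -
  have "evolve \<pi> t b = \<pi> b * p t b b + (\<Sum>a\<in>S - {b}. \<pi> a * p t a b)"
    unfolding evolve_def using assms finite_S by (subst sum.remove[of S b]) auto
  moreover have "p t b b = 1 - (\<Sum>a\<in>S - {b}. p t b a)"
    using p_sum[OF assms] sum.remove[OF finite_S assms(2), of "p t b"] by simp
  ultimately show ?thesis
    by (simp add: sum_subtractf sum_distrib_left algebra_simps)
qed

text \<open>Inflow minus outflow at \<open>b\<close>: the forward equation at time 0.\<close>

lemma evolve_diff_rate:
  assumes "b \<in> S"
  shows "((\<lambda>h. (evolve \<pi> h b - \<pi> b) / h) \<longlongrightarrow> (\<Sum>a\<in>S - {b}. \<pi> a * q a b - \<pi> b * q b a)) (at_right 0)"
proof -
  have "((\<lambda>h. \<Sum>a\<in>S - {b}. \<pi> a * (p h a b / h) - \<pi> b * (p h b a / h))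
      \<longlongrightarrow> (\<Sum>a\<in>S - {b}. \<pi> a * q a b - \<pi> b * q b a)) (at_right 0)"
    using rates assms unfolding has_jump_rates_def
    by (intro tendsto_sum tendsto_diff tendsto_mult tendsto_const) auto
  moreover have "\<forall>\<^sub>F h in at_right 0. (\<Sum>a\<in>S - {b}. \<pi> a * (p h a b / h) - \<pi> b * (p h b a / h))
      = (evolve \<pi> h b - \<pi> b) / h"
    using eventually_at_right_less[of "0::real"]
    by eventually_elim
      (use assms in \<open>simp add: evolve_diff sum_divide_distrib diff_divide_distrib\<close>)
  ultimately show ?thesis by (rule Lim_transform_eventually)
qed

lemma stationary_imp_balance:
  assumes "stationary_distribution S p \<pi>" "b \<in> S"
  shows "(\<Sum>a\<in>S - {b}. \<pi> a * q a b - \<pi> b * q b a) = 0"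
proof -
  have "\<forall>\<^sub>F h in at_right 0. (evolve \<pi> h b - \<pi> b) / h = 0"
    using eventually_at_right_less[of "0::real"]
    by eventually_elim
      (use assms in \<open>auto simp: stationary_distribution_def evolve_def\<close>)
  then have "((\<lambda>h. (evolve \<pi> h b - \<pi> b) / h) \<longlongrightarrow> 0) (at_right 0)"
    by (rule tendsto_eventually)
  from tendsto_unique[OF _ evolve_diff_rate[OF assms(2), of \<pi>] this] show ?thesis by simp
qed

definition drift :: "('s \<Rightarrow> real) \<Rightarrow> real \<Rightarrow> real" where
  "drift \<pi> t = (\<Sum>b\<in>S. \<bar>evolve \<pi> t b - \<pi> b\<bar>)"

text \<open>A stochastic matrix contracts the \<open>\<ell>\<^sup>1\<close> norm.\<close>

lemma drift_add:
  assumes "0 \<le> s" "0 \<le> t"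
  shows "drift \<pi> (s + t) \<le> drift \<pi> s + drift \<pi> t"
proof -
  \<comment> \<open>In matrix form the displacement at time \<open>s + t\<close> is the displacement
    at time \<open>s\<close>, transported by the matrix at time \<open>t\<close>, plus the
    displacement at time \<open>t\<close>. The contraction applies to the transported part.\<close>
  have E: "evolve \<pi> (s + t) b - \<pi> b
      = (\<Sum>a\<in>S. (evolve \<pi> s a - \<pi> a) * p t a b) + (evolve \<pi> t b - \<pi> b)" if "b \<in> S" for b
  proof -
    have "evolve \<pi> (s + t) b = (\<Sum>a\<in>S. \<Sum>c\<in>S. \<pi> a * p s a c * p t c b)"
      unfolding evolve_def using assms that
      by (intro sum.cong refl) (simp add: p_add sum_distrib_left mult.assoc)
    also have "\<dots> = (\<Sum>c\<in>S. evolve \<pi> s c * p t c b)"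
      unfolding evolve_def by (subst sum.swap) (simp add: sum_distrib_right)
    finally show ?thesis
      by (simp add: left_diff_distrib sum_subtractf evolve_def[of \<pi> t])
  qed
  have "drift \<pi> (s + t) \<le> (\<Sum>b\<in>S. (\<Sum>a\<in>S. \<bar>evolve \<pi> s a - \<pi> a\<bar> * p t a b) + \<bar>evolve \<pi> t b - \<pi> b\<bar>)"
    unfolding drift_def
  proof (intro sum_mono)
    fix b assume b: "b \<in> S"
    have "\<bar>\<Sum>a\<in>S. (evolve \<pi> s a - \<pi> a) * p t a b\<bar> \<le> (\<Sum>a\<in>S. \<bar>(evolve \<pi> s a - \<pi> a) * p t a b\<bar>)"
      by (rule sum_abs)
    also have "\<dots> = (\<Sum>a\<in>S. \<bar>evolve \<pi> s a - \<pi> a\<bar> * p t a b)"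
      using p_nonneg[OF assms(2) _ b] by (intro sum.cong) (auto simp: abs_mult)
    finally show "\<bar>evolve \<pi> (s + t) b - \<pi> b\<bar>
        \<le> (\<Sum>a\<in>S. \<bar>evolve \<pi> s a - \<pi> a\<bar> * p t a b) + \<bar>evolve \<pi> t b - \<pi> b\<bar>"
      using E[OF b] by linarith
  qed
  also have "\<dots> = (\<Sum>a\<in>S. \<bar>evolve \<pi> s a - \<pi> a\<bar> * (\<Sum>b\<in>S. p t a b)) + drift \<pi> t"
    unfolding drift_def by (simp add: sum.distrib sum_distrib_left) (rule sum.swap)
  also have "(\<Sum>a\<in>S. \<bar>evolve \<pi> s a - \<pi> a\<bar> * (\<Sum>b\<in>S. p t a b)) = drift \<pi> s"
    unfolding drift_def using p_sum[OF assms(2)] by (intro sum.cong) auto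
  finally show ?thesis .
qed

lemma drift_zero: "drift \<pi> 0 = 0"
proof -
  have "evolve \<pi> 0 b = \<pi> b" if "b \<in> S" for b
    using that finite_S by (simp add: evolve_def p_zero)
  then show ?thesis by (simp add: drift_def)
qed

lemma drift_mult:
  assumes "0 \<le> t"
  shows "drift \<pi> (real k * t) \<le> real k * drift \<pi> t"
proof (induction k)
  case 0
  then show ?case by (simp add: drift_zero)
next
  case (Suc k)
  have "drift \<pi> (real k * t + t) \<le> drift \<pi> (real k * t) + drift \<pi> t"
    using assms by (intro drift_add) auto
  with Suc show ?case by (simp add: algebra_simps)
qed

text \<open>Cutting the time \<open>t\<close> into \<open>Suc k\<close> equal pieces bounds
  \<open>drift \<pi> t\<close> by \<open>t\<close> times the sum of the absolute difference
  quotients at step \<open>t / real (Suc k)\<close>. Detailed balance cancels the limits of these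
  quotients term by term, so the bound tends to 0 with growing \<open>k\<close>.\<close>

lemma detailed_balance_imp_invariant:
  assumes db: "detailed_balance S q \<pi>" and t: "0 \<le> t" and b: "b \<in> S"
  shows "evolve \<pi> t b = \<pi> b"
proof (cases "t = 0")
  case True
  with b finite_S show ?thesis by (simp add: evolve_def p_zero)
next
  case False
  with t have t: "0 < t" by simp
  have "((\<lambda>h. \<Sum>b\<in>S. \<bar>(evolve \<pi> h b - \<pi> b) / h\<bar>) \<longlongrightarrow> (\<Sum>b\<in>S. \<bar>0\<bar>)) (at_right 0)"
  proof (intro tendsto_sum tendsto_rabs)
    fix b assume b: "b \<in> S"
    have "(\<Sum>a\<in>S - {b}. \<pi> a * q a b - \<pi> b * q b a) = 0"
      using db b by (auto simp: detailed_balance_def)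
    then show "((\<lambda>h. (evolve \<pi> h b - \<pi> b) / h) \<longlongrightarrow> 0) (at_right 0)"
      using evolve_diff_rate[OF b, of \<pi>] by simp
  qed
  moreover have "filterlim (\<lambda>k. t / real (Suc k)) (at_right 0) sequentially"
    using t by real_asymp
  ultimately have "(\<lambda>k. \<Sum>b\<in>S. \<bar>(evolve \<pi> (t / real (Suc k)) b - \<pi> b) / (t / real (Suc k))\<bar>) \<longlonglongrightarrow> 0"
    using filterlim_compose by fastforce
  then have "(\<lambda>k. t * (\<Sum>b\<in>S. \<bar>(evolve \<pi> (t / real (Suc k)) b - \<pi> b) / (t / real (Suc k))\<bar>)) \<longlonglongrightarrow> t * 0"
    by (intro tendsto_mult tendsto_const)
  moreover have "drift \<pi> t \<le> t * (\<Sum>b\<in>S. \<bar>(evolve \<pi> (t / real (Suc k)) b - \<pi> b) / (t / real (Suc k))\<bar>)" for k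
  proof -
    have "drift \<pi> t \<le> real (Suc k) * drift \<pi> (t / real (Suc k))"
      using drift_mult[of "t / real (Suc k)" \<pi> "Suc k"] t by simp
    also have "\<dots> = t * (\<Sum>b\<in>S. \<bar>(evolve \<pi> (t / real (Suc k)) b - \<pi> b) / (t / real (Suc k))\<bar>)"
      unfolding drift_def using t
      by (simp add: abs_divide sum_divide_distrib[symmetric] abs_mult)
        (simp add: sum_distrib_left mult.commute)
    finally show ?thesis .
  qed
  ultimately have "drift \<pi> t \<le> 0"
    by (intro LIMSEQ_le_const[where a="drift \<pi> t" and x=0]) auto
  moreover have "\<bar>evolve \<pi> t b - \<pi> b\<bar> \<le> drift \<pi> t"
    unfolding drift_def using b finite_S by (intro member_le_sum) auto
  ultimately show ?thesis by simp
qed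

lemma detailed_balance_imp_stationary:
  assumes "detailed_balance S q \<pi>" "\<And>a. a \<in> S \<Longrightarrow> 0 \<le> \<pi> a" "(\<Sum>a\<in>S. \<pi> a) = 1"
  shows "stationary_distribution S p \<pi>"
  using detailed_balance_imp_invariant[OF assms(1)] assms(2,3)
  by (simp add: stationary_distribution_def evolve_def)

text \<open>By detailed balance the density \<open>\<rho> / \<pi>\<close> is harmonic, so it is constant where it is maximal.\<close>

lemma stationary_unique:
  assumes db: "detailed_balance S q \<pi>" and pos: "\<And>a. a \<in> S \<Longrightarrow> 0 < \<pi> a" and sum1: "(\<Sum>a\<in>S. \<pi> a) = 1"
    and q_nonneg: "\<And>a b. \<lbrakk>a \<in> S; b \<in> S\<rbrakk> \<Longrightarrow> 0 \<le> q a b"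
    and irred: "\<And>a b. \<lbrakk>a \<in> S; b \<in> S\<rbrakk> \<Longrightarrow> (\<lambda>a b. a \<in> S \<and> b \<in> S \<and> 0 < q a b)\<^sup>*\<^sup>* a b"
    and \<rho>: "stationary_distribution S p \<rho>" and a: "a \<in> S"
  shows "\<rho> a = \<pi> a"
proof -
  define r where "r b = \<rho> b / \<pi> b" for b
  have \<rho>_eq: "\<rho> b = r b * \<pi> b" if "b \<in> S" for b using pos[OF that] by (simp add: r_def)
  have harm: "(\<Sum>c\<in>S - {b}. q b c * (r b - r c)) = 0" if b: "b \<in> S" for b
  proof -
    \<comment> \<open>Detailed balance replaces the incoming rate \<open>q c b\<close> by the
      outgoing rate \<open>q b c\<close>, which turns the balance equation of \<open>\<rho>\<close>
      into harmonicity of \<open>r\<close>.\<close>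
    have "(\<Sum>c\<in>S - {b}. \<rho> c * q c b - \<rho> b * q b c) = (\<Sum>c\<in>S - {b}. - \<pi> b * (q b c * (r b - r c)))"
    proof (intro sum.cong refl)
      fix c assume c: "c \<in> S - {b}"
      have "\<pi> c * q c b = \<pi> b * q b c" using db b c by (auto simp: detailed_balance_def)
      then have "\<rho> c * q c b = r c * (\<pi> b * q b c)" using c by (simp add: \<rho>_eq)
      then show "\<rho> c * q c b - \<rho> b * q b c = - \<pi> b * (q b c * (r b - r c))"
        using b by (simp add: \<rho>_eq algebra_simps)
    qed
    then have "- \<pi> b * (\<Sum>c\<in>S - {b}. q b c * (r b - r c)) = 0"
      using stationary_imp_balance[OF \<rho> b] by (simp add: sum_distrib_left)
    with pos[OF b] show ?thesis by simp
  qed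
  have ne: "S \<noteq> {}" using a by auto
  define R where "R = Max (r ` S)"
  have R_ge: "r b \<le> R" if "b \<in> S" for b using that finite_S by (simp add: R_def)
  have "R \<in> r ` S" unfolding R_def using finite_S ne by (intro Max_in) auto
  then obtain m where m: "m \<in> S" "r m = R" by auto
  have step: "r c = R" if "b \<in> S" "c \<in> S" "r b = R" "0 < q b c" for b c
  proof (rule ccontr)
    assume "r c \<noteq> R"
    with that have "c \<in> S - {b}" by auto
    \<comment> \<open>Where \<open>r\<close> is maximal no summand of the harmonicity equation is
      negative, so each of them vanishes.\<close>
    moreover have "0 \<le> q b d * (r b - r d)" if "d \<in> S - {b}" for d
      using that q_nonneg[of b d] R_ge[of d] \<open>b \<in> S\<close> \<open>r b = R\<close> by simp
    ultimately have "q b c * (r b - r c) = 0"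
      using harm[OF that(1)] finite_S sum_nonneg_eq_0_iff[of "S - {b}" "\<lambda>c. q b c * (r b - r c)"] by blast
    with that \<open>r c \<noteq> R\<close> show False by simp
  qed
  have R: "r b = R" if "b \<in> S" for b
    using irred[OF m(1) that]
    by (induction rule: rtranclp_induct) (use m step in auto)
  \<comment> \<open>Both distributions have total mass 1, which fixes the constant.\<close>
  have "(\<Sum>b\<in>S. \<rho> b) = R * (\<Sum>b\<in>S. \<pi> b)"
    by (simp add: sum_distrib_left \<rho>_eq R)
  then have "R = 1" using \<rho> sum1 by (simp add: stationary_distribution_def)
  then show ?thesis using R[OF a] \<rho>_eq[OF a] by simp
qed

end

section \<open>The potential game\<close>

context spectrum_network
begin

lemma finite_users [simp]: "finite (users G)"
  by (simp add: users_def)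

text \<open>Physical interference and its social surcharge in one weight. Indicators replace the
  neighbour sets, so that all sums run over the same set of users and symmetry can be used
  freely.\<close>

definition pair_weight :: "(nat \<Rightarrow> 'c) \<Rightarrow> nat \<Rightarrow> nat \<Rightarrow> real" where
  "pair_weight a n m = of_bool (m \<in> phys_nbrs G n) * (1 + of_bool (m \<in> soc_nbrs G n) * tie G n m)
     * interference G a m n"

lemma interference_sym:
  assumes "n \<in> users G" "m \<in> users G" "m \<noteq> n"
  shows "interference G a m n = interference G a n m"
  unfolding interference_def distance_sym[OF assms] power_equal[OF assms(1,2)]
  by (simp add: eq_commute)

text \<open>Equal powers, symmetric distances, undirected graphs and symmetric ties combine here
  into the one property that makes the game a potential game.\<close>

lemma pair_weight_sym:
  assumes "n \<in> users G" "m \<in> users G"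
  shows "pair_weight a n m = pair_weight a m n"
proof (cases "n = m")
  case False
  have "of_bool (m \<in> soc_nbrs G n) * tie G n m = of_bool (n \<in> soc_nbrs G m) * tie G m n"
    using soc_nbrs_sym[OF assms] tie_sym[OF assms(1), of m] by (cases "m \<in> soc_nbrs G n") simp_all
  moreover have "interference G a m n = interference G a n m"
    using False assms by (intro interference_sym) auto
  ultimately show ?thesis
    unfolding pair_weight_def phys_nbrs_sym[OF assms] by simp
qed simp

lemma pair_weight_self: "n \<in> users G \<Longrightarrow> pair_weight a n n = 0"
  using phys_nbrs_users[of n] by (auto simp: pair_weight_def)

lemma potential_eq:
  "potential G a = - (1/2) * (\<Sum>n\<in>users G. \<Sum>m\<in>users G. pair_weight a n m) - (\<Sum>n\<in>users G. noise G n (a n))"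
proof -
  have "(\<Sum>m\<in>users G. pair_weight a n m)
      = (\<Sum>m\<in>phys_nbrs G n. interference G a m n)
        + (\<Sum>m\<in>phys_nbrs G n \<inter> soc_nbrs G n. tie G n m * interference G a m n)" if n: "n \<in> users G" for n
  proof -
    have sub: "phys_nbrs G n \<subseteq> users G" using phys_nbrs_users[OF n] by auto
    have "(\<Sum>m\<in>users G. pair_weight a n m) = (\<Sum>m\<in>phys_nbrs G n. pair_weight a n m)"
      by (intro sum.mono_neutral_right sub) (auto simp: pair_weight_def)
    also have "\<dots> = (\<Sum>m\<in>phys_nbrs G n. interference G a m n
        + of_bool (m \<in> soc_nbrs G n) * (tie G n m * interference G a m n))"
      by (intro sum.cong) (auto simp: pair_weight_def algebra_simps)
    also have "\<dots> = (\<Sum>m\<in>phys_nbrs G n. interference G a m n)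
        + (\<Sum>m\<in>phys_nbrs G n. of_bool (m \<in> soc_nbrs G n) * (tie G n m * interference G a m n))"
      by (rule sum.distrib)
    also have "(\<Sum>m\<in>phys_nbrs G n. of_bool (m \<in> soc_nbrs G n) * (tie G n m * interference G a m n))
        = (\<Sum>m\<in>phys_nbrs G n \<inter> soc_nbrs G n. tie G n m * interference G a m n)"
      using finite_subset[OF sub] by (simp add: sum.inter_restrict of_bool_def if_distrib[of "\<lambda>x. x * _"] cong: if_cong)
    finally show ?thesis .
  qed
  then show ?thesis
    by (simp add: potential_def sum.distrib algebra_simps)
qed

text \<open>By symmetry the row and the column of \<open>n\<close> in the double sum agree, which
  cancels the factor 1/2. The part in parentheses does not involve \<open>a n\<close>.\<close>

lemma potential_split:
  assumes n: "n \<in> users G"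
  shows "potential G a = - (\<Sum>m\<in>users G - {n}. pair_weight a n m) - noise G n (a n)
    + (- (1/2) * (\<Sum>k\<in>users G - {n}. \<Sum>m\<in>users G - {n}. pair_weight a k m)
       - (\<Sum>k\<in>users G - {n}. noise G k (a k)))"
proof -
  have "(\<Sum>k\<in>users G. \<Sum>m\<in>users G. pair_weight a k m)
      = (\<Sum>m\<in>users G. pair_weight a n m) + (\<Sum>k\<in>users G - {n}. \<Sum>m\<in>users G. pair_weight a k m)"
    using n by (intro sum.remove) auto
  also have "(\<Sum>m\<in>users G. pair_weight a n m) = (\<Sum>m\<in>users G - {n}. pair_weight a n m)"
    using n by (subst sum.remove[of _ n]) (auto simp: pair_weight_self)
  \<comment> \<open>The column of \<open>n\<close> is split off and written as a second copy of its
    row.\<close>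
  also have "(\<Sum>k\<in>users G - {n}. \<Sum>m\<in>users G. pair_weight a k m)
      = (\<Sum>k\<in>users G - {n}. pair_weight a n k + (\<Sum>m\<in>users G - {n}. pair_weight a k m))"
    using n by (intro sum.cong refl) (subst sum.remove[of _ n], auto simp: pair_weight_sym)
  finally have "(\<Sum>k\<in>users G. \<Sum>m\<in>users G. pair_weight a k m)
      = 2 * (\<Sum>m\<in>users G - {n}. pair_weight a n m) + (\<Sum>k\<in>users G - {n}. \<Sum>m\<in>users G - {n}. pair_weight a k m)"
    by (simp add: sum.distrib)
  moreover have "(\<Sum>k\<in>users G. noise G k (a k)) = noise G n (a n) + (\<Sum>k\<in>users G - {n}. noise G k (a k))"
    using n by (intro sum.remove) auto
  ultimately show ?thesis by (simp add: potential_eq algebra_simps)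
qed

text \<open>Caring about a friend who is also a physical neighbour means counting the shared
  interference once more, with the weight of the tie; this is exactly the surcharge in
  \<open>pair_weight\<close>. The last sum runs over \<open>k\<close> and \<open>m\<close> different
  from \<open>n\<close> and hence does not involve \<open>a n\<close>.\<close>

lemma social_utility_split:
  assumes n: "n \<in> users G"
  shows "social_utility G n a = - (\<Sum>m\<in>users G - {n}. pair_weight a n m) - noise G n (a n)
    - (\<Sum>m\<in>soc_nbrs G n. tie G n m * ((\<Sum>k\<in>phys_nbrs G m - {n}. interference G a k m) + noise G m (a m)))"
proof -
  have soc: "soc_nbrs G n \<subseteq> users G - {n}" and phys: "phys_nbrs G n \<subseteq> users G - {n}"
    using soc_nbrs_users[OF n] phys_nbrs_users[OF n] by auto
  have "tie G n m * utility G m a = - (of_bool (m \<in> phys_nbrs G n) * (tie G n m * interference G a m n))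
      - tie G n m * ((\<Sum>k\<in>phys_nbrs G m - {n}. interference G a k m) + noise G m (a m))"
    if m: "m \<in> soc_nbrs G n" for m
  proof -
    have mu: "m \<in> users G" "m \<noteq> n" using m soc by auto
    have fin: "finite (phys_nbrs G m)"
      using phys_nbrs_users[OF mu(1)] by (rule finite_subset) auto
    \<comment> \<open>Of the interference suffered by the friend \<open>m\<close>, only the summand
      caused by \<open>n\<close> sees the channel of \<open>n\<close>; by symmetry it equals the
      interference that \<open>m\<close> causes at \<open>n\<close>.\<close>
    have "(\<Sum>k\<in>phys_nbrs G m. interference G a k m)
        = of_bool (m \<in> phys_nbrs G n) * interference G a m n + (\<Sum>k\<in>phys_nbrs G m - {n}. interference G a k m)"
      using phys_nbrs_sym[OF n mu(1)] interference_sym[OF n mu(1) mu(2), of a] sum.remove[OF fin, of n]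
      by (cases "n \<in> phys_nbrs G m") auto
    then show ?thesis by (simp add: utility_def algebra_simps)
  qed
  then have "(\<Sum>m\<in>soc_nbrs G n. tie G n m * utility G m a)
      = - (\<Sum>m\<in>soc_nbrs G n. of_bool (m \<in> phys_nbrs G n) * (tie G n m * interference G a m n))
        - (\<Sum>m\<in>soc_nbrs G n. tie G n m * ((\<Sum>k\<in>phys_nbrs G m - {n}. interference G a k m) + noise G m (a m)))"
    by (simp add: sum_subtractf sum_negf)
  also have "(\<Sum>m\<in>soc_nbrs G n. of_bool (m \<in> phys_nbrs G n) * (tie G n m * interference G a m n))
      = (\<Sum>m\<in>users G - {n}. of_bool (m \<in> soc_nbrs G n) * (of_bool (m \<in> phys_nbrs G n) * (tie G n m * interference G a m n)))"
    using soc by (intro sum.mono_neutral_cong_left) auto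
  finally have A: "(\<Sum>m\<in>soc_nbrs G n. tie G n m * utility G m a)
      = - (\<Sum>m\<in>users G - {n}. of_bool (m \<in> soc_nbrs G n) * (of_bool (m \<in> phys_nbrs G n) * (tie G n m * interference G a m n)))
        - (\<Sum>m\<in>soc_nbrs G n. tie G n m * ((\<Sum>k\<in>phys_nbrs G m - {n}. interference G a k m) + noise G m (a m)))" .
  have "(\<Sum>m\<in>phys_nbrs G n. interference G a m n)
      = (\<Sum>m\<in>users G - {n}. of_bool (m \<in> phys_nbrs G n) * interference G a m n)"
    using phys by (intro sum.mono_neutral_cong_left) auto
  then have "(\<Sum>m\<in>phys_nbrs G n. interference G a m n)
      + (\<Sum>m\<in>users G - {n}. of_bool (m \<in> soc_nbrs G n) * (of_bool (m \<in> phys_nbrs G n) * (tie G n m * interference G a m n)))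
      = (\<Sum>m\<in>users G - {n}. pair_weight a n m)"
    by (simp add: sum.distrib[symmetric] pair_weight_def algebra_simps del: of_bool_eq_0_iff sum_mult_of_bool_eq sum_of_bool_mult_eq)
  then show ?thesis
    unfolding social_utility_def A utility_def[of G n a] by linarith
qed

text \<open>In the two splittings the parts that involve \<open>a n\<close> are identical, and
  everything else cancels in the differences.\<close>

lemma social_utility_potential:
  assumes n: "n \<in> users G"
  shows "social_utility G n (a(n := c)) - social_utility G n a = potential G (a(n := c)) - potential G a"
proof -
  have W: "pair_weight (a(n := c)) k m = pair_weight a k m" if "k \<noteq> n" "m \<noteq> n" for k m
    using that by (simp add: pair_weight_def interference_def)
  have I: "interference G (a(n := c)) k m = interference G a k m" if "k \<noteq> n" "m \<noteq> n" for k m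
    using that by (simp add: interference_def)
  have "(\<Sum>m\<in>soc_nbrs G n. tie G n m * ((\<Sum>k\<in>phys_nbrs G m - {n}. interference G (a(n := c)) k m) + noise G m ((a(n := c)) m)))
    = (\<Sum>m\<in>soc_nbrs G n. tie G n m * ((\<Sum>k\<in>phys_nbrs G m - {n}. interference G a k m) + noise G m (a m)))"
    using soc_nbrs_users[OF n] I by (intro sum.cong refl arg_cong2[of _ _ _ _ "(*)"] arg_cong2[of _ _ _ _ "(+)"]) auto
  moreover have "(\<Sum>k\<in>users G - {n}. \<Sum>m\<in>users G - {n}. pair_weight (a(n := c)) k m)
    = (\<Sum>k\<in>users G - {n}. \<Sum>m\<in>users G - {n}. pair_weight a k m)"
    using W by (intro sum.cong) auto
  moreover have "(\<Sum>k\<in>users G - {n}. noise G k ((a(n := c)) k)) = (\<Sum>k\<in>users G - {n}. noise G k (a k))"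
    by (intro sum.cong) auto
  ultimately show ?thesis
    by (simp add: potential_split[OF n] social_utility_split[OF n])
qed

section \<open>Profiles, the Gibbs distribution and the transition rates\<close>

lemma finite_profiles [simp]: "finite (profiles G)"
  unfolding profiles_def using channels_finite by (intro finite_PiE) auto

lemma profiles_nonempty: "profiles G \<noteq> {}"
  unfolding profiles_def using channels_nonempty by (simp add: PiE_eq_empty_iff)

lemma profile_upd:
  assumes "a \<in> profiles G" "n \<in> users G" "c \<in> channels G n"
  shows "a(n := c) \<in> profiles G"
  using assms by (auto simp: profiles_def PiE_iff extensional_def)

lemma gibbs_pos: "0 < gibbs G \<theta> a"
  unfolding gibbs_def using profiles_nonempty by (intro divide_pos_pos sum_pos) auto

lemma gibbs_sum: "(\<Sum>a\<in>profiles G. gibbs G \<theta> a) = 1"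
proof -
  have "(\<Sum>b\<in>profiles G. exp (\<theta> * potential G b)) > 0"
    using profiles_nonempty by (intro sum_pos) auto
  then show ?thesis by (simp add: gibbs_def sum_divide_distrib[symmetric])
qed

text \<open>Profiles are extensional: outside the users both functions are \<open>undefined\<close>,
  so agreement on the other users gives equality of functions.\<close>

lemma profiles_differ_eq:
  assumes "a \<in> profiles G" "b \<in> profiles G" "n \<in> users G"
    and "\<And>m. m \<in> users G \<Longrightarrow> a m \<noteq> b m \<Longrightarrow> m = n"
  shows "b = a(n := b n)"
proof
  fix m
  have "b m = a m" if "m \<noteq> n"
  proof (cases "m \<in> users G")
    case True
    with assms(4) that show ?thesis by metis
  next
    case False
    with assms(1,2) show ?thesis unfolding profiles_def by (metis PiE_arb)
  qed
  then show "b m = (a(n := b n)) m" by simp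
qed

lemma transition_rate_single:
  assumes "n \<in> users G" "a n \<noteq> c"
  shows "transition_rate G \<theta> \<tau> a (a(n := c)) = \<tau> n / real (card (channels G n)) * move_prob G \<theta> n a c"
proof -
  have "\<exists>!m. m \<in> users G \<and> a m \<noteq> (a(n := c)) m" using assms by auto
  moreover have "(THE m. m \<in> users G \<and> a m \<noteq> (a(n := c)) m) = n"
    using assms by (intro the_equality) (auto split: if_splits)
  ultimately show ?thesis
    unfolding transition_rate_def by (simp add: move_prob_def)
qed

lemma transition_rate_other:
  assumes "\<nexists>!n. n \<in> users G \<and> a n \<noteq> b n"
  shows "transition_rate G \<theta> \<tau> a b = 0"
  using assms by (simp add: transition_rate_def)

text \<open>The maximum in the acceptance probability is the same for a move and its reversal, as
  are \<open>\<tau> n\<close> and the number of channels. What remains is the exponential form of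
  the exact potential property.\<close>

lemma gibbs_detailed_balance: "detailed_balance (profiles G) (transition_rate G \<theta> \<tau>) (gibbs G \<theta>)"
  unfolding detailed_balance_def
proof (intro ballI)
  fix a b assume ab: "a \<in> profiles G" "b \<in> profiles G"
  show "gibbs G \<theta> a * transition_rate G \<theta> \<tau> a b = gibbs G \<theta> b * transition_rate G \<theta> \<tau> b a"
  proof (cases "\<exists>!n. n \<in> users G \<and> a n \<noteq> b n")
    case False
    then have "\<nexists>!n. n \<in> users G \<and> b n \<noteq> a n" by metis
    with False show ?thesis by (simp add: transition_rate_other)
  next
    case True
    then obtain n where n: "n \<in> users G" "a n \<noteq> b n" and uniq: "\<And>m. m \<in> users G \<Longrightarrow> a m \<noteq> b m \<Longrightarrow> m = n"
      unfolding Ex1_def by blast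
    have b: "a(n := b n) = b"
      by (rule profiles_differ_eq[OF ab n(1) uniq, symmetric])
    have a: "b(n := a n) = a"
      by (rule profiles_differ_eq[OF ab(2,1) n(1) uniq, symmetric]) auto
    have "potential G a + social_utility G n b = potential G b + social_utility G n a"
      using social_utility_potential[OF n(1), of a "b n"] unfolding b by linarith
    then have "\<theta> * potential G a + \<theta> * social_utility G n b = \<theta> * potential G b + \<theta> * social_utility G n a"
      by (metis distrib_left)
    then have "exp (\<theta> * potential G a) * exp (\<theta> * social_utility G n b)
        = exp (\<theta> * potential G b) * exp (\<theta> * social_utility G n a)"
      by (simp add: exp_add[symmetric])
    moreover have "transition_rate G \<theta> \<tau> a b = \<tau> n / real (card (channels G n)) * move_prob G \<theta> n a (b n)"
      using transition_rate_single[OF n(1), of a "b n" \<theta> \<tau>] n b by simp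
    moreover have "transition_rate G \<theta> \<tau> b a = \<tau> n / real (card (channels G n)) * move_prob G \<theta> n b (a n)"
      using transition_rate_single[OF n(1), of b "a n" \<theta> \<tau>] n a by auto
    ultimately show ?thesis
      unfolding gibbs_def move_prob_def a b by (simp add: max.commute mult.left_commute)
  qed
qed

lemma move_prob_pos: "0 < move_prob G \<theta> n a c"
  unfolding move_prob_def by (simp add: less_max_iff_disj)

lemma move_prob_le: "move_prob G \<theta> n a c \<le> 1"
  unfolding move_prob_def by (simp add: divide_le_eq less_max_iff_disj)

lemma transition_rate_nonneg:
  assumes "\<And>n. n \<in> users G \<Longrightarrow> \<tau> n > 0" "a \<in> profiles G" "b \<in> profiles G"
  shows "0 \<le> transition_rate G \<theta> \<tau> a b"
proof (cases "\<exists>!n. n \<in> users G \<and> a n \<noteq> b n")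
  case True
  then obtain n where n: "n \<in> users G" "a n \<noteq> b n" and uniq: "\<And>m. m \<in> users G \<Longrightarrow> a m \<noteq> b m \<Longrightarrow> m = n"
    unfolding Ex1_def by blast
  have "a(n := b n) = b"
    by (rule profiles_differ_eq[OF assms(2,3) n(1) uniq, symmetric])
  then show ?thesis
    using transition_rate_single[OF n(1), of a "b n" \<theta> \<tau>] n assms(1)[OF n(1)] move_prob_pos[of \<theta> n a "b n"]
    by simp
qed (simp add: transition_rate_other)

text \<open>A profile is reached from another by changing the channels of the users one by one.\<close>

lemma transition_rate_irreducible:
  assumes \<tau>: "\<And>n. n \<in> users G \<Longrightarrow> \<tau> n > 0" and a: "a \<in> profiles G" and b: "b \<in> profiles G"
  shows "(\<lambda>a b. a \<in> profiles G \<and> b \<in> profiles G \<and> 0 < transition_rate G \<theta> \<tau> a b)\<^sup>*\<^sup>* a b"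
proof -
  define R where "R = (\<lambda>a b. a \<in> profiles G \<and> b \<in> profiles G \<and> 0 < transition_rate G \<theta> \<tau> a b)"
  have b_chan: "b n \<in> channels G n" if "n \<in> users G" for n
    using b that by (auto simp: profiles_def)
  define mix where "mix A = (\<lambda>n. if n \<in> A then b n else a n)" for A
  have "mix A \<in> profiles G \<and> R\<^sup>*\<^sup>* a (mix A)" if "A \<subseteq> users G" for A
    using finite_subset[OF that finite_users] that
  proof (induction rule: finite_induct)
    case empty
    then show ?case using a by (simp add: mix_def)
  next
    case (insert n A)
    have n: "n \<in> users G" using insert.prems by simp
    have c: "mix A \<in> profiles G" and reach: "R\<^sup>*\<^sup>* a (mix A)"
      using insert.IH insert.prems by simp_all
    have eq: "mix (insert n A) = (mix A)(n := b n)" by (auto simp: mix_def)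
    have c': "(mix A)(n := b n) \<in> profiles G" using c n b_chan[OF n] by (rule profile_upd)
    \<comment> \<open>If user \<open>n\<close> already has the target channel, no step is taken: the
      rate from a profile to itself is 0.\<close>
    have "R\<^sup>*\<^sup>* (mix A) ((mix A)(n := b n))"
    proof (cases "mix A n = b n")
      case True
      then have "(mix A)(n := b n) = mix A" by (simp add: fun_upd_idem)
      then show ?thesis by simp
    next
      case False
      have "card (channels G n) > 0"
        using channels_finite[OF n] channels_nonempty[OF n] by (simp add: card_gt_0_iff)
      then have "0 < transition_rate G \<theta> \<tau> (mix A) ((mix A)(n := b n))"
        using transition_rate_single[where a="mix A", OF n False, of \<theta> \<tau>] \<tau>[OF n]
          move_prob_pos[of \<theta> n "mix A" "b n"] by simp
      with c c' have "R (mix A) ((mix A)(n := b n))" by (simp add: R_def)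
      then show ?thesis by (rule r_into_rtranclp[of R])
    qed
    with rtranclp_trans[OF reach this] c' show ?case unfolding eq by (intro conjI)
  qed
  from this[of "users G"] have "R\<^sup>*\<^sup>* a (mix (users G))" by simp
  also have "mix (users G) = b"
    using a b by (auto simp: mix_def profiles_def PiE_def extensional_def)
  finally show ?thesis unfolding R_def .
qed

end

section \<open>A single exponential clock\<close>

text \<open>
  Keeps the rings of \<open>x\<close> up to time \<open>s\<close>; the first later ring is moved to \<open>s\<close> plus the first waiting
  time of \<open>y\<close>, and from there on \<open>y\<close> is followed.
\<close>

fun resample :: "real \<Rightarrow> (nat \<Rightarrow> real \<times> 'm) \<Rightarrow> (nat \<Rightarrow> real \<times> 'm) \<Rightarrow> nat \<Rightarrow> real \<times> 'm" where
  "resample s x y 0 = (if s < fst (x 0) then (s + fst (y 0), snd (y 0)) else x 0)"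
| "resample s x y (Suc j) =
     (if s < fst (x 0) then y (Suc j) else resample (s - fst (x 0)) (\<lambda>i. x (Suc i)) y j)"

definition row_time :: "(nat \<Rightarrow> real \<times> 'm) \<Rightarrow> nat \<Rightarrow> real" where
  "row_time x k = (\<Sum>j\<le>k. fst (x j))"

lemma row_time_0 [simp]: "row_time x 0 = fst (x 0)"
  by (simp add: row_time_def)

lemma row_time_Suc_shift: "row_time x (Suc k) = fst (x 0) + row_time (\<lambda>i. x (Suc i)) k"
  unfolding row_time_def by (rule sum.atMost_Suc_shift)

text \<open>\<open>K\<close> is the first index with a ring after \<open>s\<close>; the induction on
  \<open>K\<close> drops the first wait and lowers \<open>s\<close> by it. The wait at index
  \<open>K\<close> mixes the elapsed part of \<open>x\<close> with the first wait of
  \<open>y\<close>, so the future is described by ring times and marks and not by entries.\<close>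

lemma resample_past:
  assumes "\<And>k. k < K \<Longrightarrow> row_time x k \<le> s" "s < row_time x K"
  shows "j < K \<Longrightarrow> resample s x y j = x j"
    and "row_time (resample s x y) (K + k) = s + row_time y k"
    and "snd (resample s x y (K + k)) = snd (y k)"
proof -
  have "(\<forall>j<K. resample s x y j = x j) \<and>
        (\<forall>k. row_time (resample s x y) (K + k) = s + row_time y k \<and> snd (resample s x y (K + k)) = snd (y k))"
    using assms
  proof (induction K arbitrary: s x)
    case 0
    then have s: "s < fst (x 0)" by simp
    have "row_time (resample s x y) k = s + row_time y k" for k
      using s by (cases k) (simp_all add: row_time_Suc_shift)
    moreover have "snd (resample s x y k) = snd (y k)" for k
      using s by (cases k) simp_all
    ultimately show ?case by simp
  next
    case (Suc K)
    let ?x = "\<lambda>i. x (Suc i)"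
    have s: "\<not> s < fst (x 0)" using Suc.prems(1)[of 0] by simp
    have "row_time ?x k \<le> s - fst (x 0)" if "k < K" for k
      using Suc.prems(1)[of "Suc k"] that by (simp add: row_time_Suc_shift)
    moreover have "s - fst (x 0) < row_time ?x K"
      using Suc.prems(2) by (simp add: row_time_Suc_shift)
    ultimately have IH: "\<forall>j<K. resample (s - fst (x 0)) ?x y j = ?x j"
      "\<And>k. row_time (resample (s - fst (x 0)) ?x y) (K + k) = s - fst (x 0) + row_time y k"
      "\<And>k. snd (resample (s - fst (x 0)) ?x y (K + k)) = snd (y k)"
      using Suc.IH[of ?x "s - fst (x 0)"] by blast+
    have "resample s x y j = x j" if "j < Suc K" for j
      using that s IH(1) by (cases j) auto
    moreover have "row_time (resample s x y) (Suc K + k) = s + row_time y k" for k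
      using s IH(2)[of k] by (simp add: row_time_Suc_shift)
    moreover have "snd (resample s x y (Suc K + k)) = snd (y k)" for k
      using s IH(3)[of k] by simp
    ultimately show ?case by blast
  qed
  then show "j < K \<Longrightarrow> resample s x y j = x j"
    and "row_time (resample s x y) (K + k) = s + row_time y k"
    and "snd (resample s x y (K + k)) = snd (y k)"
    by blast+
qed

section \<open>Exponential waiting times with independent marks\<close>

locale clock =
  fixes l :: real and Q :: "'m measure"
  assumes l_pos: "0 < l" and mark_prob: "prob_space Q"
begin

definition D :: "real measure" where "D = density lborel (exponential_density l)"

definition E :: "(real \<times> 'm) measure" where "E = D \<Otimes>\<^sub>M Q"

sublocale D: prob_space D
  unfolding D_def using l_pos by (rule prob_space_exponential_density)

sublocale Q: prob_space Q
  by (rule mark_prob)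

sublocale DQ: pair_prob_space D Q ..

sublocale E: prob_space E
  unfolding E_def by (rule DQ.prob_space_axioms)

sublocale sequence_space E ..

lemma sets_D [simp, measurable_cong]: "sets D = sets borel"
  by (simp add: D_def)

lemma sets_E [measurable_cong]: "sets E = sets (borel \<Otimes>\<^sub>M Q)"
  unfolding E_def by (rule sets_pair_measure_cong) simp_all

text \<open>Translation by \<open>s\<close> multiplies the exponential density by a constant on the
  positive half-line. The form with a general \<open>f\<close> gives the whole residual law and not
  only its tail.\<close>

lemma memoryless_D:
  assumes [measurable]: "f \<in> borel_measurable borel" and s: "0 \<le> s"
  shows "(\<integral>\<^sup>+w. indicator {s<..} w * f w \<partial>D) = ennreal (exp (- l * s)) * (\<integral>\<^sup>+w. f (s + w) \<partial>D)"
proof -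
  have "(\<integral>\<^sup>+w. indicator {s<..} w * f w \<partial>D)
      = (\<integral>\<^sup>+w. ennreal (exponential_density l w) * (indicator {s<..} w * f w) \<partial>lborel)"
    unfolding D_def by (rule nn_integral_density) measurable
  also have "\<dots> = (\<integral>\<^sup>+w. ennreal (exponential_density l (s + w)) * (indicator {s<..} (s + w) * f (s + w)) \<partial>lborel)"
    by (subst nn_integral_real_affine[where c=1 and t=s]) auto
  also have "\<dots> = (\<integral>\<^sup>+w. ennreal (exp (- l * s)) * (ennreal (exponential_density l w) * f (s + w)) \<partial>lborel)"
  proof (rule nn_integral_cong_AE)
    \<comment> \<open>The single point 0 has to be left out: there the density is positive, while
      the strict inequality in the indicator fails.\<close>
    have "AE w in lborel. w \<noteq> (0::real)" by (rule AE_lborel_singleton)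
    then show "AE w in lborel. ennreal (exponential_density l (s + w)) * (indicator {s<..} (s + w) * f (s + w))
        = ennreal (exp (- l * s)) * (ennreal (exponential_density l w) * f (s + w))"
    proof eventually_elim
      case (elim w)
      have "exponential_density l (s + w) = exp (- l * s) * exponential_density l w" if "0 < w"
        using that s by (simp add: exponential_density_def exp_add[symmetric] algebra_simps)
      then show ?case
        using elim l_pos by (cases "0 < w")
          (auto simp: ennreal_mult exponential_density_nonneg mult.assoc, simp add: exponential_density_def)
    qed
  qed
  also have "\<dots> = ennreal (exp (- l * s)) * (\<integral>\<^sup>+w. ennreal (exponential_density l w) * f (s + w) \<partial>lborel)"
    by (rule nn_integral_cmult) measurable
  also have "(\<integral>\<^sup>+w. ennreal (exponential_density l w) * f (s + w) \<partial>lborel) = (\<integral>\<^sup>+w. f (s + w) \<partial>D)"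
    unfolding D_def by (rule nn_integral_density[symmetric]) measurable
  finally show ?thesis .
qed

lemma memoryless_E:
  assumes f [measurable]: "f \<in> borel_measurable E" and s: "0 \<le> s"
  shows "(\<integral>\<^sup>+e. indicator {s<..} (fst e) * f e \<partial>E) = ennreal (exp (- l * s)) * (\<integral>\<^sup>+e. f (s + fst e, snd e) \<partial>E)"
proof -
  note f' [measurable] = f[unfolded E_def]
  have f'' [measurable]: "f \<in> borel_measurable (borel \<Otimes>\<^sub>M Q)"
    using f by (simp cong: measurable_cong_sets add: sets_E)
  have "(\<integral>\<^sup>+e. indicator {s<..} (fst e) * f e \<partial>E) = (\<integral>\<^sup>+m. \<integral>\<^sup>+w. indicator {s<..} w * f (w, m) \<partial>D \<partial>Q)"
    unfolding E_def by (subst DQ.nn_integral_snd[symmetric]) simp_all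
  also have "\<dots> = (\<integral>\<^sup>+m. ennreal (exp (- l * s)) * (\<integral>\<^sup>+w. f (s + w, m) \<partial>D) \<partial>Q)"
    using s by (intro nn_integral_cong memoryless_D) measurable
  also have "\<dots> = ennreal (exp (- l * s)) * (\<integral>\<^sup>+m. \<integral>\<^sup>+w. f (s + w, m) \<partial>D \<partial>Q)"
    by (rule nn_integral_cmult) measurable
  also have "(\<integral>\<^sup>+m. \<integral>\<^sup>+w. f (s + w, m) \<partial>D \<partial>Q) = (\<integral>\<^sup>+e. f (s + fst e, snd e) \<partial>E)"
    unfolding E_def by (subst DQ.nn_integral_snd[symmetric]) simp_all
  finally show ?thesis .
qed

lemma emeasure_wait_gt:
  assumes "0 \<le> t"
  shows "emeasure E {e\<in>space E. t < fst e} = ennreal (exp (- l * t))"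
proof -
  have "emeasure E {e\<in>space E. t < fst e} = (\<integral>\<^sup>+e. indicator {t<..} (fst e) * 1 \<partial>E)"
    by (subst nn_integral_indicator[symmetric], measurable)
      (intro nn_integral_cong, auto simp: indicator_def)
  also have "\<dots> = ennreal (exp (- l * t)) * (\<integral>\<^sup>+e. 1 \<partial>E)"
    using assms by (rule memoryless_E[rotated]) simp
  finally show ?thesis by (simp add: E.emeasure_space_1)
qed

lemma wait_pos_AE: "AE e in E. 0 < fst e"
  using emeasure_wait_gt[of 0] by (intro E.AE_I_eq_1) simp_all

lemma emeasure_wait_le:
  assumes "0 \<le> t"
  shows "emeasure E {e\<in>space E. fst e \<le> t} = ennreal (1 - exp (- l * t))"
proof -
  have "{e\<in>space E. fst e \<le> t} = space E - {e\<in>space E. t < fst e}" by auto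
  moreover have "emeasure E (space E - {e\<in>space E. t < fst e}) = emeasure E (space E) - ennreal (exp (- l * t))"
    using emeasure_wait_gt[OF assms] by (subst emeasure_compl) auto
  ultimately show ?thesis
    by (simp add: E.emeasure_space_1 ennreal_minus[symmetric] del: ennreal_minus)
qed

text \<open>The lower bound 0 on the wait holds almost surely and does not change the probability.
  It is part of the event so that, at every sample point of it, a second wait longer than
  \<open>t\<close> makes the second ring come after \<open>t\<close>.\<close>

lemma wait_mark:
  assumes t: "0 \<le> t" and B [measurable]: "B \<in> sets Q"
  shows sets_wait_mark: "{e\<in>space E. 0 \<le> fst e \<and> fst e \<le> t \<and> snd e \<in> B} \<in> sets E"
    and measure_wait_mark: "measure E {e\<in>space E. 0 \<le> fst e \<and> fst e \<le> t \<and> snd e \<in> B} = (1 - exp (- l * t)) * measure Q B"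
proof -
  have times: "measure E ({..t} \<times> C) = measure D {..t} * measure Q C" if "C \<in> sets Q" for C
    using that by (simp add: E_def measure_def Q.emeasure_pair_measure_Times enn2real_mult)
  have "measure E {e\<in>space E. fst e \<le> t} = 1 - exp (- l * t)"
    using emeasure_wait_le[OF t] l_pos t by (simp add: measure_def)
  also have "{e\<in>space E. fst e \<le> t} = {..t} \<times> space Q"
    by (auto simp: E_def D_def space_pair_measure)
  finally have D: "measure D {..t} = 1 - exp (- l * t)"
    using times[OF sets.top] by (simp add: Q.prob_space)
  have box: "{..t} \<times> B \<in> sets E" unfolding sets_E by measurable
  have sub: "{..t} \<times> B \<subseteq> space E" using sets.sets_into_space[OF box] .
  have "{e\<in>space E. 0 \<le> fst e \<and> fst e \<le> t \<and> snd e \<in> B} = {0..t} \<times> B"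
    using sub by (auto simp: subset_eq)
  also have "\<dots> \<in> sets E" unfolding sets_E by measurable
  finally show sets: "{e\<in>space E. 0 \<le> fst e \<and> fst e \<le> t \<and> snd e \<in> B} \<in> sets E" .
  have "measure E {e\<in>space E. 0 \<le> fst e \<and> fst e \<le> t \<and> snd e \<in> B} = measure E {e\<in>space E. e \<in> {..t} \<times> B}"
  proof (rule E.prob_eq_AE)
    show "AE e in E. (0 \<le> fst e \<and> fst e \<le> t \<and> snd e \<in> B) = (e \<in> {..t} \<times> B)"
      using wait_pos_AE by eventually_elim auto
    show "{e\<in>space E. 0 \<le> fst e \<and> fst e \<le> t \<and> snd e \<in> B} \<in> sets E" by (rule sets)
    show "{e\<in>space E. e \<in> {..t} \<times> B} \<in> sets E"
      using box sub by (simp add: Collect_conj_eq Int_absorb1)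
  qed
  also have "{e\<in>space E. e \<in> {..t} \<times> B} = {..t} \<times> B" using sub by auto
  finally show "measure E {e\<in>space E. 0 \<le> fst e \<and> fst e \<le> t \<and> snd e \<in> B} = (1 - exp (- l * t)) * measure Q B"
    using times[OF B] D by simp
qed

lemma measure_wait_gt:
  assumes "0 \<le> t"
  shows "{e\<in>space E. t < fst e} \<in> sets E" "measure E {e\<in>space E. t < fst e} = exp (- l * t)"
proof -
  show "{e\<in>space E. t < fst e} \<in> sets E" by measurable
  show "measure E {e\<in>space E. t < fst e} = exp (- l * t)"
    unfolding measure_def emeasure_wait_gt[OF assms] by simp
qed

section \<open>Sequences of waiting times: splitting off the first one, and resampling\<close>

lemma nn_integral_S:
  assumes [measurable]: "F \<in> borel_measurable S"
  shows "(\<integral>\<^sup>+x. F x \<partial>S) = (\<integral>\<^sup>+e. \<integral>\<^sup>+x. F (case_nat e x) \<partial>S \<partial>E)"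
proof -
  have "(\<integral>\<^sup>+x. F x \<partial>S) = (\<integral>\<^sup>+x. F x \<partial>distr (E \<Otimes>\<^sub>M S) S (\<lambda>(s, \<omega>). case_nat s \<omega>))"
    by (simp add: PiM_iter)
  also have "\<dots> = (\<integral>\<^sup>+z. F (case_nat (fst z) (snd z)) \<partial>(E \<Otimes>\<^sub>M S))"
    by (subst nn_integral_distr) (auto simp: case_prod_beta)
  also have "\<dots> = (\<integral>\<^sup>+e. \<integral>\<^sup>+x. F (case_nat e x) \<partial>S \<partial>E)"
    by (subst P.nn_integral_fst[symmetric]) simp_all
  finally show ?thesis .
qed

lemma S_prob: "prob_space S"
  by (rule P.prob_space_axioms)

lemma nn_integral_box:
  assumes A [measurable]: "\<And>j. A j \<in> sets E"
  shows "(\<integral>\<^sup>+x. (\<Prod>j<m. indicator (A j) (x j)) \<partial>S) = (\<Prod>j<m. emeasure E (A j))"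
proof -
  have "(\<integral>\<^sup>+x. (\<Prod>j<m. indicator (A j) (x j)) \<partial>S)
      = (\<integral>\<^sup>+x. indicator (prod_emb UNIV (\<lambda>_. E) {..<m} (Pi\<^sub>E {..<m} A)) x \<partial>S)"
  proof (intro nn_integral_cong)
    fix x assume x: "x \<in> space S"
    show "(\<Prod>j<m. indicator (A j) (x j)) = (indicator (prod_emb UNIV (\<lambda>_. E) {..<m} (Pi\<^sub>E {..<m} A)) x :: ennreal)"
    proof (cases "\<forall>j<m. x j \<in> A j")
      case True
      then have "x \<in> prod_emb UNIV (\<lambda>_. E) {..<m} (Pi\<^sub>E {..<m} A)"
        using x by (auto simp: prod_emb_def space_PiM)
      with True show ?thesis by simp
    next
      case False
      then obtain j where j: "j < m" "x j \<notin> A j" by auto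
      then have "x \<notin> prod_emb UNIV (\<lambda>_. E) {..<m} (Pi\<^sub>E {..<m} A)"
        by (auto simp: prod_emb_def PiE_iff)
      moreover have "(\<Prod>j<m. indicator (A j) (x j)) = (0::ennreal)"
        using j by (intro prod_zero bexI[of _ j]) auto
      ultimately show ?thesis by simp
    qed
  qed
  also have "\<dots> = emeasure S (prod_emb UNIV (\<lambda>_. E) {..<m} (Pi\<^sub>E {..<m} A))"
    by (intro nn_integral_indicator sets_PiM_I) auto
  also have "\<dots> = (\<Prod>j<m. emeasure E (A j))"
    by (intro emeasure_PiM_emb) auto
  finally show ?thesis .
qed

lemma measurable_shift [measurable (raw)]:
  assumes [measurable]: "g \<in> measurable M S"
  shows "(\<lambda>w. \<lambda>i. g w (Suc i)) \<in> measurable M S"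
proof (rule measurable_PiM_single')
  fix i
  show "(\<lambda>w. g w (Suc i)) \<in> measurable M E" by measurable
next
  show "(\<lambda>w i. g w (Suc i)) \<in> space M \<rightarrow> (\<Pi>\<^sub>E i\<in>UNIV. space E)"
    using measurable_space[OF assms] by (auto simp: space_PiM PiE_iff)
qed

lemma measurable_pair_E [measurable (raw)]:
  assumes [measurable]: "f \<in> borel_measurable M" and [measurable]: "g \<in> measurable M E"
  shows "(\<lambda>w. (f w + fst (g w), snd (g w))) \<in> measurable M E"
    "(\<lambda>w. fst (g w)) \<in> borel_measurable M"
proof -
  have g: "g \<in> measurable M (borel \<Otimes>\<^sub>M Q)"
    using assms(2) by (simp cong: measurable_cong_sets add: sets_E)
  note [measurable] = measurable_compose[OF g measurable_fst] measurable_compose[OF g measurable_snd]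
  have "(\<lambda>w. (f w + fst (g w), snd (g w))) \<in> measurable M (borel \<Otimes>\<^sub>M Q)" by measurable
  then show "(\<lambda>w. (f w + fst (g w), snd (g w))) \<in> measurable M E"
    by (simp cong: measurable_cong_sets add: sets_E)
  show "(\<lambda>w. fst (g w)) \<in> borel_measurable M" by measurable
qed

lemma measurable_resample_nth [measurable (raw)]:
  assumes "f \<in> borel_measurable M" "g \<in> measurable M S" "h \<in> measurable M S"
  shows "(\<lambda>w. resample (f w) (g w) (h w) j) \<in> measurable M E"
  using assms
proof (induction j arbitrary: f g)
  case 0
  note [measurable] = 0
  show ?case by simp
next
  case (Suc j)
  note [measurable] = Suc.prems
  have [measurable]: "(\<lambda>w. resample (f w - fst (g w 0)) (\<lambda>i. g w (Suc i)) (h w) j) \<in> measurable M E"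
    by (rule Suc.IH) measurable
  show ?case by simp
qed

lemma measurable_resample [measurable (raw)]:
  assumes "f \<in> borel_measurable M" "g \<in> measurable M S" "h \<in> measurable M S"
  shows "(\<lambda>w. resample (f w) (g w) (h w)) \<in> measurable M S"
  using measurable_resample_nth[OF assms]
  by (intro measurable_PiM_single') (auto simp: PiE_iff dest: measurable_space)

text \<open>Induction along the sequence with \<open>s\<close> and \<open>A\<close> general. If the
  first ring comes after \<open>s\<close>, all later entries are fresh and independent of the first;
  if it comes before, the same problem recurs with the remaining time and one factor less.\<close>

lemma resample_box:
  assumes "0 \<le> s" "\<And>j. A j \<in> sets E"
  shows "(\<integral>\<^sup>+x. \<integral>\<^sup>+y. (\<Prod>j<m. indicator (A j) (resample s x y j)) \<partial>S \<partial>S) = (\<Prod>j<m. emeasure E (A j))"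
  using assms
proof (induction m arbitrary: s A)
  case 0
  then show ?case by (simp add: P.emeasure_space_1)
next
  case (Suc m)
  note A [measurable] = Suc.prems(2)
  let ?P = "\<Prod>j<m. emeasure E (A (Suc j))"
  let ?C = "\<integral>\<^sup>+e. indicator (A 0) (s + fst e, snd e) \<partial>E"
  have inner: "(\<integral>\<^sup>+x. \<integral>\<^sup>+y. (\<Prod>j<Suc m. indicator (A j) (resample s (case_nat e x) y j)) \<partial>S \<partial>S)
      = indicator {s<..} (fst e) * (?C * ?P) + indicator {..s} (fst e) * indicator (A 0) e * ?P"
    if e: "e \<in> space E" for e
  proof (cases "s < fst e")
    case True
    have "(\<integral>\<^sup>+x. \<integral>\<^sup>+y. (\<Prod>j<Suc m. indicator (A j) (resample s (case_nat e x) y j)) \<partial>S \<partial>S)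
        = (\<integral>\<^sup>+x. \<integral>\<^sup>+y. indicator (A 0) (s + fst (y 0), snd (y 0)) * (\<Prod>j<m. indicator (A (Suc j)) (y (Suc j))) \<partial>S \<partial>S)"
      unfolding prod.lessThan_Suc_shift using True by simp
    also have "\<dots> = (\<integral>\<^sup>+y. indicator (A 0) (s + fst (y 0), snd (y 0)) * (\<Prod>j<m. indicator (A (Suc j)) (y (Suc j))) \<partial>S)"
      by (simp add: P.emeasure_space_1)
    also have "\<dots> = (\<integral>\<^sup>+e. \<integral>\<^sup>+y. indicator (A 0) (s + fst e, snd e) * (\<Prod>j<m. indicator (A (Suc j)) (y j)) \<partial>S \<partial>E)"
      by (subst nn_integral_S) simp_all
    also have "\<dots> = (\<integral>\<^sup>+e. indicator (A 0) (s + fst e, snd e) * ?P \<partial>E)"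
      by (intro nn_integral_cong) (simp add: nn_integral_cmult nn_integral_box)
    also have "\<dots> = ?C * ?P"
      by (rule nn_integral_multc) measurable
    finally show ?thesis using True by simp
  next
    case False
    have "(\<integral>\<^sup>+x. \<integral>\<^sup>+y. (\<Prod>j<Suc m. indicator (A j) (resample s (case_nat e x) y j)) \<partial>S \<partial>S)
        = (\<integral>\<^sup>+x. \<integral>\<^sup>+y. indicator (A 0) e * (\<Prod>j<m. indicator (A (Suc j)) (resample (s - fst e) x y j)) \<partial>S \<partial>S)"
      unfolding prod.lessThan_Suc_shift using False by simp
    also have "\<dots> = (\<integral>\<^sup>+x. indicator (A 0) e * (\<integral>\<^sup>+y. (\<Prod>j<m. indicator (A (Suc j)) (resample (s - fst e) x y j)) \<partial>S) \<partial>S)"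
      by (intro nn_integral_cong nn_integral_cmult) measurable
    also have "\<dots> = indicator (A 0) e * (\<integral>\<^sup>+x. \<integral>\<^sup>+y. (\<Prod>j<m. indicator (A (Suc j)) (resample (s - fst e) x y j)) \<partial>S \<partial>S)"
      by (intro nn_integral_cmult) measurable
    also have "(\<integral>\<^sup>+x. \<integral>\<^sup>+y. (\<Prod>j<m. indicator (A (Suc j)) (resample (s - fst e) x y j)) \<partial>S \<partial>S) = ?P"
      using False A by (intro Suc.IH) auto
    finally show ?thesis using False by simp
  qed
  have "(\<integral>\<^sup>+x. \<integral>\<^sup>+y. (\<Prod>j<Suc m. indicator (A j) (resample s x y j)) \<partial>S \<partial>S)
      = (\<integral>\<^sup>+e. \<integral>\<^sup>+x. \<integral>\<^sup>+y. (\<Prod>j<Suc m. indicator (A j) (resample s (case_nat e x) y j)) \<partial>S \<partial>S \<partial>E)"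
    by (rule nn_integral_S) measurable
  also have "\<dots> = (\<integral>\<^sup>+e. indicator {s<..} (fst e) * (?C * ?P) + indicator {..s} (fst e) * indicator (A 0) e * ?P \<partial>E)"
    by (rule nn_integral_cong) (rule inner)
  also have "\<dots> = (\<integral>\<^sup>+e. indicator {s<..} (fst e) * (?C * ?P) \<partial>E) + (\<integral>\<^sup>+e. indicator {..s} (fst e) * indicator (A 0) e * ?P \<partial>E)"
    by (rule nn_integral_add) measurable
  also have "(\<integral>\<^sup>+e. indicator {s<..} (fst e) * (?C * ?P) \<partial>E) = ennreal (exp (- l * s)) * (?C * ?P)"
    using Suc.prems(1) by (subst memoryless_E) (auto simp: E.emeasure_space_1)
  \<comment> \<open>Memorylessness read backwards: \<open>s\<close> plus a fresh wait has the law of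
    a wait given that it exceeds \<open>s\<close>, so both cases reassemble to the measure of
    \<open>A 0\<close>.\<close>
  also have "\<dots> = (\<integral>\<^sup>+e. indicator {s<..} (fst e) * indicator (A 0) e \<partial>E) * ?P"
    using Suc.prems(1) by (subst memoryless_E) (auto simp: mult.assoc)
  also have "\<dots> = (\<integral>\<^sup>+e. indicator {s<..} (fst e) * indicator (A 0) e * ?P \<partial>E)"
    by (rule nn_integral_multc[symmetric]) measurable
  also have "\<dots> + (\<integral>\<^sup>+e. indicator {..s} (fst e) * indicator (A 0) e * ?P \<partial>E)
      = (\<integral>\<^sup>+e. indicator {s<..} (fst e) * indicator (A 0) e * ?P + indicator {..s} (fst e) * indicator (A 0) e * ?P \<partial>E)"
    by (rule nn_integral_add[symmetric]) measurable
  also have "\<dots> = (\<integral>\<^sup>+e. indicator (A 0) e * ?P \<partial>E)"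
    by (intro nn_integral_cong) (auto simp: indicator_def)
  also have "\<dots> = emeasure E (A 0) * ?P"
    by (subst nn_integral_multc) auto
  finally show ?case unfolding prod.lessThan_Suc_shift by simp
qed

lemma distr_resample:
  assumes s: "0 \<le> s"
  shows "distr (S \<Otimes>\<^sub>M S) S (\<lambda>(x, y). resample s x y) = S"
proof (rule PiM_eq)
  fix J :: "nat set" and F
  assume J: "finite J" and F: "\<And>j. j \<in> J \<Longrightarrow> F j \<in> sets E"
  \<comment> \<open>A cylinder over \<open>J\<close> becomes one over an initial segment, the form
    that the induction along the sequence needs, by putting the whole space at the missing
    indices.\<close>
  define A where "A j = (if j \<in> J then F j else space E)" for j
  have A [measurable]: "A j \<in> sets E" for j using F by (auto simp: A_def)
  obtain m where m: "J \<subseteq> {..<m}" using finite_nat_iff_bounded[of J] J by auto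
  let ?X = "prod_emb UNIV (\<lambda>_. E) J (Pi\<^sub>E J F)"
  have X [measurable]: "?X \<in> sets S" using J F by (intro sets_PiM_I) auto
  interpret SS: pair_prob_space S S ..
  have "emeasure (distr (S \<Otimes>\<^sub>M S) S (\<lambda>(x, y). resample s x y)) ?X
      = (\<integral>\<^sup>+z. indicator ?X (case_prod (resample s) z) \<partial>(S \<Otimes>\<^sub>M S))"
    by (subst nn_integral_indicator[symmetric], simp) (subst nn_integral_distr, auto)
  also have "\<dots> = (\<integral>\<^sup>+x. \<integral>\<^sup>+y. indicator ?X (resample s x y) \<partial>S \<partial>S)"
    by (subst P.nn_integral_fst[symmetric]) (auto simp: case_prod_beta)
  also have "\<dots> = (\<integral>\<^sup>+x. \<integral>\<^sup>+y. (\<Prod>j<m. indicator (A j) (resample s x y j)) \<partial>S \<partial>S)"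
  proof (intro nn_integral_cong)
    fix x y assume xy: "x \<in> space S" "y \<in> space S"
    have "resample s x y \<in> space S"
      using measurable_space[OF measurable_resample[of "\<lambda>_. s" "S \<Otimes>\<^sub>M S" fst snd], of "(x, y)"] xy
      by (simp add: space_pair_measure)
    then have r: "resample s x y j \<in> space E" for j by (auto simp: space_PiM PiE_iff)
    show "indicator ?X (resample s x y) = (\<Prod>j<m. indicator (A j) (resample s x y j) :: ennreal)"
    proof (cases "resample s x y \<in> ?X")
      case True
      then have "resample s x y j \<in> A j" for j
        using r by (auto simp: A_def prod_emb_def PiE_iff)
      with True show ?thesis by simp
    next
      case False
      then obtain j where j: "j \<in> J" "resample s x y j \<notin> F j"
        using r by (auto simp: prod_emb_def PiE_iff)
      then have "(\<Prod>j<m. indicator (A j) (resample s x y j)) = (0 :: ennreal)"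
        using m by (intro prod_zero) (auto simp: A_def intro!: bexI[of _ j])
      with False show ?thesis by simp
    qed
  qed
  also have "\<dots> = (\<Prod>j<m. emeasure E (A j))"
    using s by (intro resample_box) auto
  also have "\<dots> = (\<Prod>j\<in>J. emeasure E (F j))"
    using m by (intro prod.mono_neutral_cong_right) (auto simp: A_def E.emeasure_space_1)
  finally show "emeasure (distr (S \<Otimes>\<^sub>M S) S (\<lambda>(x, y). resample s x y)) ?X = (\<Prod>j\<in>J. emeasure E (F j))" .
qed simp

lemma measurable_row_time [measurable (raw)]:
  assumes [measurable]: "g \<in> measurable M S"
  shows "(\<lambda>w. row_time (g w) k) \<in> borel_measurable M"
  unfolding row_time_def by measurable

text \<open>Let \<open>f t\<close> be the probability that all rings come by time \<open>t\<close>.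
  The first ring must come by \<open>t\<close>, and the remaining clock must stay within even less
  time; so \<open>f t\<close> is at most \<open>f t\<close> times the probability of a wait up to
  \<open>t\<close>. That factor is below 1, hence \<open>f t = 0\<close>. Natural numbers as bounds
  keep the union of null sets countable.\<close>

lemma row_time_unbounded_AE: "AE x in S. \<forall>t. \<exists>k. t < row_time x k"
proof -
  define f where "f t = emeasure S {x\<in>space S. \<forall>k. row_time x k \<le> t}" for t
  have f_int: "f t = (\<integral>\<^sup>+x. indicator {x\<in>space S. \<forall>k. row_time x k \<le> t} x \<partial>S)" for t
    unfolding f_def by (rule nn_integral_indicator[symmetric]) measurable
  have f_mono: "f s \<le> f t" if "s \<le> t" for s t
    unfolding f_def using that by (intro emeasure_mono) (auto intro: order_trans)
  have f0: "f t = 0" if t: "0 \<le> t" for t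
  proof -
    have "f t = (\<integral>\<^sup>+e. \<integral>\<^sup>+x. indicator {x\<in>space S. \<forall>k. row_time x k \<le> t} (case_nat e x) \<partial>S \<partial>E)"
      unfolding f_int by (rule nn_integral_S) measurable
    also have "\<dots> \<le> (\<integral>\<^sup>+e. indicator {e\<in>space E. fst e \<le> t} e * f t \<partial>E)"
    proof (rule nn_integral_mono_AE, use wait_pos_AE AE_space in eventually_elim)
      fix e assume elim: "0 < fst e" "e \<in> space E"
      have "(\<integral>\<^sup>+x. indicator {x\<in>space S. \<forall>k. row_time x k \<le> t} (case_nat e x) \<partial>S)
          \<le> (\<integral>\<^sup>+x. indicator {e\<in>space E. fst e \<le> t} e * indicator {x\<in>space S. \<forall>k. row_time x k \<le> t - fst e} x \<partial>S)"
      proof (intro nn_integral_mono)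
        fix x assume x: "x \<in> space S"
        have "fst e \<le> t \<and> (\<forall>k. row_time x k \<le> t - fst e)" if *: "\<forall>k. row_time (case_nat e x) k \<le> t"
        proof (intro conjI allI)
          show "fst e \<le> t" using *[rule_format, of 0] by simp
          show "row_time x k \<le> t - fst e" for k
            using *[rule_format, of "Suc k"] by (simp add: row_time_Suc_shift)
        qed
        then show "(indicator {x\<in>space S. \<forall>k. row_time x k \<le> t} (case_nat e x) :: ennreal)
          \<le> indicator {e\<in>space E. fst e \<le> t} e * indicator {x\<in>space S. \<forall>k. row_time x k \<le> t - fst e} x"
          using elim x by (auto simp: indicator_def)
      qed
      also have "\<dots> = indicator {e\<in>space E. fst e \<le> t} e * f (t - fst e)"
        unfolding f_int by (rule nn_integral_cmult) measurable
      also have "\<dots> \<le> indicator {e\<in>space E. fst e \<le> t} e * f t"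
        using elim by (intro mult_left_mono f_mono) auto
      finally show "(\<integral>\<^sup>+x. indicator {x\<in>space S. \<forall>k. row_time x k \<le> t} (case_nat e x) \<partial>S)
        \<le> indicator {e\<in>space E. fst e \<le> t} e * f t" .
    qed
    also have "\<dots> = emeasure E {e\<in>space E. fst e \<le> t} * f t"
      by (subst nn_integral_multc) auto
    also have "\<dots> = ennreal (1 - exp (- l * t)) * f t"
      using t by (simp add: emeasure_wait_le)
    finally have *: "f t \<le> ennreal (1 - exp (- l * t)) * f t" .
    have ft: "f t = ennreal (measure S {x\<in>space S. \<forall>k. row_time x k \<le> t})"
      unfolding f_def by (rule P.emeasure_eq_measure)
    have "exp (- l * t) \<le> 1" using l_pos t by simp
    then have "measure S {x\<in>space S. \<forall>k. row_time x k \<le> t}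
        \<le> (1 - exp (- l * t)) * measure S {x\<in>space S. \<forall>k. row_time x k \<le> t}"
      using * unfolding ft by (subst (asm) ennreal_mult[symmetric]) (auto simp: mult_nonneg_nonneg)
    then have "exp (- l * t) * measure S {x\<in>space S. \<forall>k. row_time x k \<le> t} \<le> 0"
      by (simp add: algebra_simps)
    then have "measure S {x\<in>space S. \<forall>k. row_time x k \<le> t} = 0"
      by (simp add: mult_le_0_iff) (use measure_nonneg antisym in blast)
    then show ?thesis by (simp add: ft)
  qed
  have "AE x in S. \<forall>n::nat. \<not> (\<forall>k. row_time x k \<le> real n)"
    unfolding AE_all_countable
  proof
    fix n :: nat
    have "{x\<in>space S. \<forall>k. row_time x k \<le> real n} \<in> null_sets S"
      using f0[of "real n"] by (intro null_setsI) (auto simp: f_def)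
    then show "AE x in S. \<not> (\<forall>k. row_time x k \<le> real n)"
      by (rule AE_I') auto
  qed
  then show ?thesis
  proof eventually_elim
    case (elim x)
    show ?case
    proof
      fix t :: real
      obtain n :: nat where "t < real n" using reals_Archimedean2 by blast
      moreover obtain k where "real n < row_time x k" using elim by (auto simp: not_le)
      ultimately show "\<exists>k. t < row_time x k" by (meson less_trans)
    qed
  qed
qed

end

section \<open>Independent clocks\<close>

text \<open>The indicator of a box is a product over the coordinates, and integrals of such products
  over a finite product space factorise: once in \<open>y\<close> with \<open>x\<close> fixed, then
  in \<open>x\<close>. It lifts the invariance under resampling from one clock to all
  clocks.\<close>

lemma distr_PiM_pair_components:
  fixes M :: "'i \<Rightarrow> 'a measure"
  assumes prob: "\<And>i. prob_space (M i)" and fin: "finite I"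
    and h [measurable]: "\<And>i. h i \<in> measurable (M i \<Otimes>\<^sub>M M i) (M i)"
    and h_distr: "\<And>i. distr (M i \<Otimes>\<^sub>M M i) (M i) (h i) = M i"
  shows "(\<lambda>(x, y). \<lambda>i\<in>I. h i (x i, y i)) \<in> measurable (PiM I M \<Otimes>\<^sub>M PiM I M) (PiM I M)"
    and "distr (PiM I M \<Otimes>\<^sub>M PiM I M) (PiM I M) (\<lambda>(x, y). \<lambda>i\<in>I. h i (x i, y i)) = PiM I M"
proof -
  interpret M: prob_space "M i" for i by (rule prob)
  interpret product_prob_space M I ..
  interpret I: finite_product_prob_space M I by unfold_locales (rule fin)
  interpret II: pair_prob_space "PiM I M" "PiM I M" ..
  let ?H = "\<lambda>(x, y). \<lambda>i\<in>I. h i (x i, y i)"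
  show H [measurable]: "?H \<in> measurable (PiM I M \<Otimes>\<^sub>M PiM I M) (PiM I M)"
    unfolding case_prod_beta by measurable
  show "distr (PiM I M \<Otimes>\<^sub>M PiM I M) (PiM I M) ?H = PiM I M"
  proof (rule PiM_eqI[OF fin])
    fix A assume A: "\<And>i. i \<in> I \<Longrightarrow> A i \<in> sets (M i)"
    have box [measurable]: "Pi\<^sub>E I A \<in> sets (PiM I M)" using A fin by (intro sets_PiM_I_finite)
    have A' [measurable]: "(\<lambda>v. indicator (A i) v :: ennreal) \<in> borel_measurable (M i)" if "i \<in> I" for i
      using A[OF that] by (rule borel_measurable_indicator)
    have hA [measurable]: "(\<lambda>z. indicator (A i) (h i z) :: ennreal) \<in> borel_measurable (M i \<Otimes>\<^sub>M M i)" if "i \<in> I" for i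
      using measurable_compose[OF h A'[OF that]] .
    have ind: "indicator (Pi\<^sub>E I A) (?H (x, y)) = (\<Prod>i\<in>I. indicator (A i) (h i (x i, y i)) :: ennreal)" for x y
    proof (cases "\<forall>i\<in>I. h i (x i, y i) \<in> A i")
      case True
      then show ?thesis by simp
    next
      case False
      then obtain i where i: "i \<in> I" "h i (x i, y i) \<notin> A i" by auto
      then have "(\<Prod>i\<in>I. indicator (A i) (h i (x i, y i))) = (0 :: ennreal)"
        using fin by (intro prod_zero bexI[of _ i]) auto
      moreover have "?H (x, y) \<notin> Pi\<^sub>E I A" using i by (auto simp: PiE_iff)
      ultimately show ?thesis by simp
    qed
    have "emeasure (distr (PiM I M \<Otimes>\<^sub>M PiM I M) (PiM I M) ?H) (Pi\<^sub>E I A)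
        = (\<integral>\<^sup>+z. indicator (Pi\<^sub>E I A) (?H z) \<partial>(PiM I M \<Otimes>\<^sub>M PiM I M))"
      by (subst nn_integral_indicator[symmetric], simp) (rule nn_integral_distr, measurable)
    also have "\<dots> = (\<integral>\<^sup>+x. \<integral>\<^sup>+y. indicator (Pi\<^sub>E I A) (?H (x, y)) \<partial>PiM I M \<partial>PiM I M)"
      by (rule P.nn_integral_fst[symmetric]) measurable
    also have "\<dots> = (\<integral>\<^sup>+x. (\<Prod>i\<in>I. \<integral>\<^sup>+v. indicator (A i) (h i (x i, v)) \<partial>M i) \<partial>PiM I M)"
    proof (intro nn_integral_cong)
      fix x assume x: "x \<in> space (PiM I M)"
      have "(\<integral>\<^sup>+y. indicator (Pi\<^sub>E I A) (?H (x, y)) \<partial>PiM I M)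
          = (\<integral>\<^sup>+y. (\<Prod>i\<in>I. indicator (A i) (h i (x i, y i))) \<partial>PiM I M)"
        unfolding ind ..
      also have "\<dots> = (\<Prod>i\<in>I. \<integral>\<^sup>+v. indicator (A i) (h i (x i, v)) \<partial>M i)"
      proof (rule product_nn_integral_prod[OF fin])
        fix i assume i: "i \<in> I"
        then have "x i \<in> space (M i)" using x by (auto simp: space_PiM)
        with hA[OF i] show "(\<lambda>v. indicator (A i) (h i (x i, v)) :: ennreal) \<in> borel_measurable (M i)"
          by measurable
      qed
      finally show "(\<integral>\<^sup>+y. indicator (Pi\<^sub>E I A) (?H (x, y)) \<partial>PiM I M) = \<dots>" .
    qed
    also have "\<dots> = (\<Prod>i\<in>I. \<integral>\<^sup>+u. \<integral>\<^sup>+v. indicator (A i) (h i (u, v)) \<partial>M i \<partial>M i)"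
    proof (rule product_nn_integral_prod[OF fin])
      fix i assume i: "i \<in> I"
      show "(\<lambda>u. \<integral>\<^sup>+v. indicator (A i) (h i (u, v)) \<partial>M i) \<in> borel_measurable (M i)"
        by (rule M.borel_measurable_nn_integral_fst) (rule hA[OF i])
    qed
    also have "\<dots> = (\<Prod>i\<in>I. emeasure (M i) (A i))"
    proof (intro prod.cong refl)
      fix i assume i: "i \<in> I"
      have "(\<integral>\<^sup>+u. \<integral>\<^sup>+v. indicator (A i) (h i (u, v)) \<partial>M i \<partial>M i)
          = (\<integral>\<^sup>+z. indicator (A i) (h i z) \<partial>(M i \<Otimes>\<^sub>M M i))"
        by (rule M.nn_integral_fst) (rule hA[OF i])
      also have "\<dots> = (\<integral>\<^sup>+v. indicator (A i) v \<partial>distr (M i \<Otimes>\<^sub>M M i) (M i) (h i))"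
        using A'[OF i] by (subst nn_integral_distr[OF h]) simp_all
      also have "\<dots> = emeasure (M i) (A i)"
        using A[OF i] by (simp add: h_distr)
      finally show "(\<integral>\<^sup>+u. \<integral>\<^sup>+v. indicator (A i) (h i (u, v)) \<partial>M i \<partial>M i) = emeasure (M i) (A i)" .
    qed
    finally show "emeasure (distr (PiM I M \<Otimes>\<^sub>M PiM I M) (PiM I M) ?H) (Pi\<^sub>E I A) = (\<Prod>i\<in>I. emeasure (M i) (A i))" .
  qed simp
qed

text \<open>Samples are indexed by pairs of a user and a round, whereas resampling acts on the whole
  row of a user. A product over pairs is a product of rows, because a finite cylinder is a box of
  row cylinders.\<close>

lemma distr_PiM_uncurry:
  fixes M :: "'i \<Rightarrow> 'j \<Rightarrow> 'a measure"
  assumes prob: "\<And>i j. prob_space (M i j)" and fin: "finite I"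
  defines "U \<equiv> \<lambda>f. \<lambda>(i, j)\<in>I \<times> UNIV. f i j"
  shows "U \<in> measurable (\<Pi>\<^sub>M i\<in>I. \<Pi>\<^sub>M j\<in>UNIV. M i j) (\<Pi>\<^sub>M (i, j)\<in>I \<times> UNIV. M i j)"
    and "distr (\<Pi>\<^sub>M i\<in>I. \<Pi>\<^sub>M j\<in>UNIV. M i j) (\<Pi>\<^sub>M (i, j)\<in>I \<times> UNIV. M i j) U = (\<Pi>\<^sub>M (i, j)\<in>I \<times> UNIV. M i j)"
proof -
  let ?R = "\<Pi>\<^sub>M i\<in>I. \<Pi>\<^sub>M j\<in>UNIV. M i j" and ?M = "\<lambda>(i, j). M i j"
  let ?P = "PiM (I \<times> UNIV) ?M"
  interpret R: product_prob_space "\<lambda>i. \<Pi>\<^sub>M j\<in>UNIV. M i j" I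
    by (intro product_prob_spaceI prob_space_PiM prob)
  interpret MM: product_prob_space ?M "I \<times> UNIV"
    by (intro product_prob_spaceI) (auto intro: prob)
  show U [measurable]: "U \<in> measurable ?R ?P"
  proof (rule measurable_PiM_single')
    fix k assume k: "k \<in> I \<times> (UNIV :: 'j set)"
    then have "(\<lambda>f. f (fst k) (snd k)) \<in> measurable ?R (M (fst k) (snd k))"
      by (intro measurable_compose[of "\<lambda>f. f (fst k)" ?R "\<Pi>\<^sub>M j\<in>UNIV. M (fst k) j" "\<lambda>f. f (snd k)"]
          measurable_component_singleton) auto
    then show "(\<lambda>f. U f k) \<in> measurable ?R (?M k)"
      using k by (simp add: U_def case_prod_beta)
  qed (auto simp: U_def space_PiM PiE_iff)
  show "distr ?R ?P U = ?P"
  proof (rule MM.PiM_eq)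
    fix J and F
    assume J: "finite J" "J \<subseteq> I \<times> (UNIV :: 'j set)" and F: "\<And>k. k \<in> J \<Longrightarrow> F k \<in> sets (?M k)"
    \<comment> \<open>The rounds of row \<open>i\<close> that the cylinder constrains.\<close>
    define J' where "J' i = {j. (i, j) \<in> J}" for i
    have fJ': "finite (J' i)" for i
      unfolding J'_def using J(1) by (rule finite_subset[rotated, OF finite_imageI[of J snd]]) force
    have F': "F (i, j) \<in> sets (M i j)" if "j \<in> J' i" for i j
      using F[of "(i, j)"] that by (simp add: J'_def)
    define B where "B i = prod_emb UNIV (M i) (J' i) (\<Pi>\<^sub>E j\<in>J' i. F (i, j))" for i
    have X: "prod_emb (I \<times> UNIV) ?M J (Pi\<^sub>E J F) \<in> sets ?P"
      using J F by (intro sets_PiM_I) auto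
    have "U -` prod_emb (I \<times> UNIV) ?M J (Pi\<^sub>E J F) \<inter> space ?R = Pi\<^sub>E I B"
    proof (intro set_eqI iffI)
      fix f assume f: "f \<in> U -` prod_emb (I \<times> UNIV) ?M J (Pi\<^sub>E J F) \<inter> space ?R"
      then have "U f (i, j) \<in> F (i, j)" if "(i, j) \<in> J" for i j
        using that by (auto simp: prod_emb_def PiE_iff)
      then have "f i j \<in> F (i, j)" if "(i, j) \<in> J" for i j
        using that J(2) by (force simp: U_def)
      with f show "f \<in> Pi\<^sub>E I B"
        by (auto simp: B_def J'_def prod_emb_def space_PiM PiE_iff)
    next
      fix f assume f: "f \<in> Pi\<^sub>E I B"
      have fF: "U f k \<in> F k" if "k \<in> J" for k
      proof -
        obtain i j where k: "k = (i, j)" by (cases k)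
        with that J(2) have "i \<in> I" "j \<in> J' i" by (auto simp: J'_def)
        with f show ?thesis by (auto simp: k U_def B_def prod_emb_def PiE_iff)
      qed
      have "f \<in> space ?R"
        using f by (auto simp: B_def prod_emb_def space_PiM PiE_iff)
      moreover from measurable_space[OF U this] have "U f \<in> prod_emb (I \<times> UNIV) ?M J (Pi\<^sub>E J F)"
        using fF unfolding prod_emb_iff by (simp add: space_PiM PiE_iff)
      ultimately show "f \<in> U -` prod_emb (I \<times> UNIV) ?M J (Pi\<^sub>E J F) \<inter> space ?R" by simp
    qed
    then have "emeasure (distr ?R ?P U) (prod_emb (I \<times> UNIV) ?M J (Pi\<^sub>E J F)) = emeasure ?R (Pi\<^sub>E I B)"
      using X by (subst emeasure_distr) auto
    also have "\<dots> = (\<Prod>i\<in>I. emeasure (\<Pi>\<^sub>M j\<in>UNIV. M i j) (B i))"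
      unfolding B_def using fin fJ' F' by (intro R.emeasure_PiM sets_PiM_I) auto
    also have "\<dots> = (\<Prod>i\<in>I. \<Prod>j\<in>J' i. emeasure (M i j) (F (i, j)))"
      unfolding B_def using fJ' F' prob by (intro prod.cong refl emeasure_PiM_emb) auto
    also have "\<dots> = (\<Prod>(i, j)\<in>Sigma I J'. emeasure (M i j) (F (i, j)))"
      using fin fJ' by (intro prod.Sigma) auto
    also have "Sigma I J' = J" using J(2) by (auto simp: J'_def)
    finally show "emeasure (distr ?R ?P U) (prod_emb (I \<times> UNIV) ?M J (Pi\<^sub>E J F)) = (\<Prod>k\<in>J. emeasure (?M k) (F k))"
      by (simp only: case_prod_beta' prod.collapse)
  qed simp
qed

section \<open>The sample space of the algorithm\<close>

locale spectrum_algorithm = spectrum_network G for G :: "'c network" +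
  fixes \<theta> :: real and \<tau> :: "nat \<Rightarrow> real"
  assumes \<tau>_pos: "\<And>n. n \<in> users G \<Longrightarrow> \<tau> n > 0"
begin

text \<open>Outside \<open>users G\<close> the clock parameters are filled in arbitrarily, to have a probability space for every index.\<close>

definition rate :: "nat \<Rightarrow> real" where
  "rate n = (if n \<in> users G then \<tau> n else 1)"

definition menu :: "nat \<Rightarrow> 'c set" where
  "menu n = (if n \<in> users G then channels G n else {undefined})"

definition marks :: "nat \<Rightarrow> ('c \<times> real) measure" where
  "marks n = uniform_count_measure (menu n) \<Otimes>\<^sub>M uniform_measure lborel {0..1}"

lemma menu_finite: "finite (menu n)" and menu_nonempty: "menu n \<noteq> {}"
  using channels_finite channels_nonempty by (auto simp: menu_def)

lemma prob_space_menu: "prob_space (uniform_count_measure (menu n))"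
  by (rule prob_space_uniform_count_measure[OF menu_finite menu_nonempty])

lemma prob_space_unit: "prob_space (uniform_measure lborel {0..1::real})"
  by (intro prob_space_uniform_measure) auto

lemma prob_space_marks: "prob_space (marks n)"
proof -
  interpret A: prob_space "uniform_count_measure (menu n)" by (rule prob_space_menu)
  interpret B: prob_space "uniform_measure lborel {0..1::real}" by (rule prob_space_unit)
  interpret AB: pair_prob_space "uniform_count_measure (menu n)" "uniform_measure lborel {0..1::real}" ..
  show ?thesis unfolding marks_def by (rule AB.prob_space_axioms)
qed

sublocale C: clock "rate n" "marks n" for n
  by (rule clock.intro) (simp_all add: rate_def \<tau>_pos prob_space_marks)

abbreviation \<Omega> :: "'c sample measure" where
  "\<Omega> \<equiv> algorithm_space G \<tau>"

lemma \<Omega>_eq: "\<Omega> = (\<Pi>\<^sub>M (n, j)\<in>users G \<times> UNIV. C.E n)"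
proof -
  have "C.E n = density lborel (exponential_density (\<tau> n)) \<Otimes>\<^sub>M
      (uniform_count_measure (channels G n) \<Otimes>\<^sub>M uniform_measure lborel {0..1})" if "n \<in> users G" for n
    unfolding C.E_def C.D_def using that by (simp add: marks_def rate_def menu_def)
  then show ?thesis
    unfolding algorithm_space_def by (intro PiM_cong) auto
qed

sublocale \<Omega>: prob_space \<Omega>
  unfolding \<Omega>_eq by (intro prob_space_PiM) (auto intro: C.E.prob_space_axioms)

lemma measurable_coord [measurable (raw)]:
  assumes "n \<in> users G" "f \<in> measurable M \<Omega>"
  shows "(\<lambda>w. f w (n, j)) \<in> measurable M (C.E n)"
  using measurable_compose[OF assms(2)[unfolded \<Omega>_eq] measurable_component_singleton[of "(n, j)"]] assms(1)
  by simp

lemma measurable_row [measurable (raw)]: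
  assumes "n \<in> users G" "f \<in> measurable M \<Omega>"
  shows "(\<lambda>w. \<lambda>j. f w (n, j)) \<in> measurable M (\<Pi>\<^sub>M j\<in>UNIV. C.E n)"
  using measurable_coord[OF assms]
  by (intro measurable_PiM_single') (auto simp: PiE_iff dest: measurable_space)

lemma distr_row:
  assumes n: "n \<in> users G"
  shows "distr \<Omega> (\<Pi>\<^sub>M j\<in>UNIV. C.E n) (\<lambda>\<omega> j. \<omega> (n, j)) = (\<Pi>\<^sub>M j\<in>UNIV. C.E n)"
  using distr_PiM_reindex[of "users G \<times> UNIV" "\<lambda>(n, j). C.E n" "\<lambda>j. (n, j)" UNIV] n
  by (simp add: \<Omega>_eq C.E.prob_space_axioms case_prod_beta inj_on_def restrict_def)

definition glue :: "real \<Rightarrow> 'c sample \<Rightarrow> 'c sample \<Rightarrow> 'c sample" where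
  "glue s \<omega> \<omega>' = (\<lambda>(n, j)\<in>users G \<times> UNIV. resample s (\<lambda>j. \<omega> (n, j)) (\<lambda>j. \<omega>' (n, j)) j)"

lemma glue_row: "n \<in> users G \<Longrightarrow> (\<lambda>j. glue s \<omega> \<omega>' (n, j)) = resample s (\<lambda>j. \<omega> (n, j)) (\<lambda>j. \<omega>' (n, j))"
  by (simp add: glue_def)

lemma measurable_glue [measurable]: "(\<lambda>(\<omega>, \<omega>'). glue s \<omega> \<omega>') \<in> measurable (\<Omega> \<Otimes>\<^sub>M \<Omega>) \<Omega>"
  unfolding case_prod_beta
proof -
  have comp: "(\<lambda>z. glue s (fst z) (snd z) k) \<in> measurable (\<Omega> \<Otimes>\<^sub>M \<Omega>) (case k of (n, j) \<Rightarrow> C.E n)"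
    if k: "k \<in> users G \<times> UNIV" for k
  proof -
    have n: "fst k \<in> users G" using k by auto
    have "(\<lambda>z. resample s (\<lambda>j. fst z (fst k, j)) (\<lambda>j. snd z (fst k, j)) (snd k))
        \<in> measurable (\<Omega> \<Otimes>\<^sub>M \<Omega>) (C.E (fst k))"
      using n by (intro C.measurable_resample_nth measurable_row measurable_fst measurable_snd borel_measurable_const)
    then show ?thesis using k by (simp add: glue_def case_prod_beta)
  qed
  show "(\<lambda>z. glue s (fst z) (snd z)) \<in> measurable (\<Omega> \<Otimes>\<^sub>M \<Omega>) \<Omega>"
    unfolding \<Omega>_eq
  proof (rule measurable_PiM_single', fold \<Omega>_eq)
    show "(\<lambda>z. glue s (fst z) (snd z)) \<in> space (\<Omega> \<Otimes>\<^sub>M \<Omega>) \<rightarrow> (\<Pi>\<^sub>E k\<in>users G \<times> UNIV. space (case k of (n, j) \<Rightarrow> C.E n))"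
    proof (intro Pi_I PiE_I)
      fix z k assume z: "z \<in> space (\<Omega> \<Otimes>\<^sub>M \<Omega>)"
      show "glue s (fst z) (snd z) k \<in> space (case k of (n, j) \<Rightarrow> C.E n)" if "k \<in> users G \<times> UNIV"
        using measurable_space[OF comp[OF that] z] .
      show "glue s (fst z) (snd z) k = undefined" if "k \<notin> users G \<times> UNIV"
        using that by (auto simp: glue_def)
    qed
  qed (rule comp)
qed

text \<open>\<open>U\<close> carries rows to samples and intertwines \<open>glue\<close> with the
  row-wise resampling \<open>H\<close>. Both maps preserve the respective measures, so
  \<open>glue\<close> does too.\<close>

lemma distr_glue:
  assumes s: "0 \<le> s"
  shows "distr (\<Omega> \<Otimes>\<^sub>M \<Omega>) \<Omega> (\<lambda>(\<omega>, \<omega>'). glue s \<omega> \<omega>') = \<Omega>"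
proof -
  let ?row = "\<lambda>n. \<Pi>\<^sub>M j\<in>(UNIV :: nat set). C.E n"
  let ?R = "PiM (users G) ?row"
  define U :: "(nat \<Rightarrow> nat \<Rightarrow> real \<times> 'c \<times> real) \<Rightarrow> 'c sample" where "U = (\<lambda>f. \<lambda>(n, j)\<in>users G \<times> UNIV. f n j)"
  define H where "H = (\<lambda>(x, y). \<lambda>n\<in>users G. resample s (x n :: nat \<Rightarrow> real \<times> 'c \<times> real) (y n))"
  have U [measurable]: "U \<in> measurable ?R \<Omega>" and dU: "distr ?R \<Omega> U = \<Omega>"
    using distr_PiM_uncurry[of "\<lambda>n j. C.E n" "users G"]
    by (simp_all add: U_def \<Omega>_eq C.E.prob_space_axioms)
  have H [measurable]: "H \<in> measurable (?R \<Otimes>\<^sub>M ?R) ?R" and dH: "distr (?R \<Otimes>\<^sub>M ?R) ?R H = ?R"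
    using distr_PiM_pair_components[of ?row "users G" "\<lambda>n (x, y). resample s x y"] C.distr_resample[OF s]
    by (simp_all add: H_def C.S_prob case_prod_beta)
  have "\<Omega> \<Otimes>\<^sub>M \<Omega> = distr ?R \<Omega> U \<Otimes>\<^sub>M distr ?R \<Omega> U" by (simp add: dU)
  also have "\<dots> = distr (?R \<Otimes>\<^sub>M ?R) (\<Omega> \<Otimes>\<^sub>M \<Omega>) (\<lambda>(x, y). (U x, U y))"
    by (rule pair_measure_distr) (simp_all add: dU \<Omega>.sigma_finite_measure_axioms)
  finally have "distr (\<Omega> \<Otimes>\<^sub>M \<Omega>) \<Omega> (\<lambda>(\<omega>, \<omega>'). glue s \<omega> \<omega>')
      = distr (?R \<Otimes>\<^sub>M ?R) \<Omega> ((\<lambda>(\<omega>, \<omega>'). glue s \<omega> \<omega>') \<circ> (\<lambda>(x, y). (U x, U y)))"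
    using distr_distr[of "\<lambda>(\<omega>, \<omega>'). glue s \<omega> \<omega>'" "\<Omega> \<Otimes>\<^sub>M \<Omega>" \<Omega> "\<lambda>(x, y). (U x, U y)" "?R \<Otimes>\<^sub>M ?R"] by simp
  also have "(\<lambda>(\<omega>, \<omega>'). glue s \<omega> \<omega>') \<circ> (\<lambda>(x, y). (U x, U y)) = U \<circ> H"
    by (auto simp: fun_eq_iff glue_def U_def H_def)
  also have "distr (?R \<Otimes>\<^sub>M ?R) \<Omega> (U \<circ> H) = distr (distr (?R \<Otimes>\<^sub>M ?R) ?R H) \<Omega> U"
    by (rule distr_distr[symmetric]) measurable
  also have "\<dots> = \<Omega>" by (simp add: dH dU)
  finally show ?thesis .
qed

text \<open>Positive first rings make the process start in the given profile and place the first
  rings of a new sample strictly after the gluing time. Unbounded ring times guarantee that a first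
  ring after any given time exists.\<close>

definition good :: "'c sample \<Rightarrow> bool" where
  "good \<omega> \<longleftrightarrow> (\<forall>n\<in>users G. 0 < ring_time \<omega> n 0 \<and> (\<forall>t. \<exists>k. t < ring_time \<omega> n k))"

lemma ring_time_row: "ring_time \<omega> n = row_time (\<lambda>j. \<omega> (n, j))"
  by (auto simp: ring_time_def row_time_def fun_eq_iff)

lemma good_AE: "AE \<omega> in \<Omega>. good \<omega>"
  unfolding good_def
proof (rule AE_finite_allI[OF finite_users])
  fix n assume n: "n \<in> users G"
  have "AE x in (\<Pi>\<^sub>M j\<in>UNIV. C.E n). 0 < row_time x 0"
    using AE_PiM_component[of UNIV "\<lambda>_. C.E n" 0 "\<lambda>e. 0 < fst e"] C.wait_pos_AE C.E.prob_space_axioms by simp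
  then have "AE x in (\<Pi>\<^sub>M j\<in>UNIV. C.E n). 0 < row_time x 0 \<and> (\<forall>t. \<exists>k. t < row_time x k)"
    using C.row_time_unbounded_AE by eventually_elim simp
  then have "AE x in distr \<Omega> (\<Pi>\<^sub>M j\<in>UNIV. C.E n) (\<lambda>\<omega> j. \<omega> (n, j)). 0 < row_time x 0 \<and> (\<forall>t. \<exists>k. t < row_time x k)"
    unfolding distr_row[OF n] .
  then show "AE \<omega> in \<Omega>. 0 < ring_time \<omega> n 0 \<and> (\<forall>t. \<exists>k. t < ring_time \<omega> n k)"
    unfolding ring_time_row
    by (rule AE_distrD[rotated, where M="\<Omega>" and M'="\<Pi>\<^sub>M j\<in>UNIV. C.E n" and f="\<lambda>\<omega> j. \<omega> (n, j)"])
      (use n in measurable)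
qed

end

section \<open>Paths of the algorithm\<close>

lemma measurable_count_space_mono:
  assumes "f \<in> measurable M (count_space UNIV)" "\<And>x. x \<in> space M \<Longrightarrow> f x \<in> A"
  shows "f \<in> measurable M (count_space A)"
  using assms by (auto simp: measurable_def)

context spectrum_algorithm
begin

lemma users_nonempty': "users G \<noteq> {}"
  using users_nonempty by (simp add: users_def)

lemma next_user:
  shows next_user_in: "next_user G \<omega> c \<in> users G"
    and next_user_le: "m \<in> users G \<Longrightarrow> ring_time \<omega> (next_user G \<omega> c) (c (next_user G \<omega> c)) \<le> ring_time \<omega> m (c m)"
proof -
  let ?r = "\<lambda>m. ring_time \<omega> m (c m)"
  have "Min (?r ` users G) \<in> ?r ` users G"
    using users_nonempty' by (intro Min_in) auto
  then obtain n where n: "n \<in> users G" "?r n = Min (?r ` users G)" by auto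
  then have "n \<in> users G \<and> (\<forall>m\<in>users G. ?r n \<le> ?r m)" by simp
  then have "next_user G \<omega> c \<in> users G \<and> (\<forall>m\<in>users G. ?r (next_user G \<omega> c) \<le> ?r m)"
    unfolding next_user_def by (rule LeastI)
  then show "next_user G \<omega> c \<in> users G"
    and "m \<in> users G \<Longrightarrow> ?r (next_user G \<omega> c) \<le> ?r m" by auto
qed

lemma run_Suc:
  assumes "run G \<theta> a \<omega> i = (b, c)" "next_user G \<omega> c = n"
  shows "run G \<theta> a \<omega> (Suc i) = (update_choice G \<theta> n (snd (\<omega> (n, c n))) b, c(n := Suc (c n)))"
    and "event_time G \<theta> a \<omega> i = ring_time \<omega> n (c n)"
  using assms by (simp_all add: event_time_def)

lemma run_count_sum: "(\<Sum>n\<in>users G. snd (run G \<theta> a \<omega> i) n) = i"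
proof (induction i)
  case (Suc i)
  obtain b c where r: "run G \<theta> a \<omega> i = (b, c)" by fastforce
  let ?n = "next_user G \<omega> c"
  have n: "?n \<in> users G" by (rule next_user_in)
  have "(\<Sum>m\<in>users G. (c(?n := Suc (c ?n))) m) = Suc (c ?n) + (\<Sum>m\<in>users G - {?n}. c m)"
    using n by (subst sum.remove[of _ ?n]) (auto intro!: sum.cong)
  also have "\<dots> = Suc (\<Sum>m\<in>users G. c m)"
    using sum.remove[OF finite_users n, of c] by simp
  finally show ?case using Suc r run_Suc(1)[OF r refl] by simp
qed simp

definition rings_by :: "'c sample \<Rightarrow> real \<Rightarrow> nat \<Rightarrow> nat" where
  "rings_by \<omega> s n = (LEAST k. s < ring_time \<omega> n k)"

definition unbounded :: "'c sample \<Rightarrow> bool" where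
  "unbounded \<omega> \<longleftrightarrow> (\<forall>n\<in>users G. \<forall>t. \<exists>k. t < ring_time \<omega> n k)"

lemma good_unbounded: "good \<omega> \<Longrightarrow> unbounded \<omega>"
  by (simp add: good_def unbounded_def)

lemma rings_by_gt: "unbounded \<omega> \<Longrightarrow> n \<in> users G \<Longrightarrow> s < ring_time \<omega> n (rings_by \<omega> s n)"
  unfolding rings_by_def unbounded_def by (rule LeastI_ex) auto

lemma rings_by_le: "k < rings_by \<omega> s n \<Longrightarrow> ring_time \<omega> n k \<le> s"
  unfolding rings_by_def using not_less_Least by fastforce

text \<open>A user whose counter has reached \<open>rings_by \<omega> s n\<close> rings next only
  after \<open>s\<close>, so no event up to time \<open>s\<close> can raise this counter.\<close>

lemma run_counts_le:
  assumes \<omega>: "unbounded \<omega>" and "\<And>j. j < i \<Longrightarrow> event_time G \<theta> a \<omega> j \<le> s" and n: "n \<in> users G"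
  shows "snd (run G \<theta> a \<omega> i) n \<le> rings_by \<omega> s n"
  using assms(2)
proof (induction i)
  case (Suc i)
  obtain b c where r: "run G \<theta> a \<omega> i = (b, c)" by fastforce
  let ?m = "next_user G \<omega> c"
  have IH: "c n \<le> rings_by \<omega> s n" using Suc r by simp
  have "ring_time \<omega> ?m (c ?m) \<le> s"
    using Suc.prems[of i] run_Suc(2)[OF r refl] by simp
  then have "Suc (c n) \<le> rings_by \<omega> s n" if "?m = n"
    using that IH rings_by_gt[OF \<omega> n, of s] by (cases "c n = rings_by \<omega> s n") auto
  with IH show ?case unfolding run_Suc(1)[OF r refl] by auto
qed simp

text \<open>Pigeonhole: each event raises one counter by 1, while all counters stay bounded as long
  as the events lie within \<open>s\<close>.\<close>

lemma event_time_unbounded: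
  assumes "unbounded \<omega>"
  shows "\<exists>i. s < event_time G \<theta> a \<omega> i"
proof (rule ccontr)
  assume "\<not> ?thesis"
  then have le: "event_time G \<theta> a \<omega> j \<le> s" for j by (simp add: not_less)
  let ?i = "Suc (\<Sum>n\<in>users G. rings_by \<omega> s n)"
  have "?i = (\<Sum>n\<in>users G. snd (run G \<theta> a \<omega> ?i) n)" by (simp only: run_count_sum)
  also have "\<dots> \<le> (\<Sum>n\<in>users G. rings_by \<omega> s n)"
    using le by (intro sum_mono run_counts_le assms)
  finally show False by simp
qed

definition events_by :: "(nat \<Rightarrow> 'c) \<Rightarrow> real \<Rightarrow> 'c sample \<Rightarrow> nat" where
  "events_by a s \<omega> = (LEAST i. s < event_time G \<theta> a \<omega> i)"

lemma spectrum_process_eq: "spectrum_process G \<theta> a s \<omega> = fst (run G \<theta> a \<omega> (events_by a s \<omega>))"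
  by (simp add: spectrum_process_def events_by_def)

lemma events_by_gt: "unbounded \<omega> \<Longrightarrow> s < event_time G \<theta> a \<omega> (events_by a s \<omega>)"
  unfolding events_by_def by (rule LeastI_ex) (rule event_time_unbounded)

lemma events_by_le: "j < events_by a s \<omega> \<Longrightarrow> event_time G \<theta> a \<omega> j \<le> s"
  unfolding events_by_def using not_less_Least by fastforce

lemma events_by_eqI:
  assumes "s < event_time G \<theta> a \<omega> i" "\<And>j. j < i \<Longrightarrow> event_time G \<theta> a \<omega> j \<le> s"
  shows "events_by a s \<omega> = i"
  unfolding events_by_def using assms by (intro Least_equality) (auto simp: not_less[symmetric])

text \<open>Both sides are first passage indices. The earliest pending ring lies after
  \<open>s\<close>, hence every pending ring does, which gives the lower bound.\<close>

lemma run_counts_eq: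
  assumes \<omega>: "unbounded \<omega>" and n: "n \<in> users G"
  shows "snd (run G \<theta> a \<omega> (events_by a s \<omega>)) n = rings_by \<omega> s n"
proof (rule antisym)
  obtain b c where r: "run G \<theta> a \<omega> (events_by a s \<omega>) = (b, c)" by fastforce
  show "snd (run G \<theta> a \<omega> (events_by a s \<omega>)) n \<le> rings_by \<omega> s n"
    using events_by_le by (intro run_counts_le \<omega> n)
  have "s < ring_time \<omega> n (c n)"
    using events_by_gt[OF \<omega>, of s a] run_Suc(2)[OF r refl] next_user_le[OF n, of \<omega> c] by simp
  then show "rings_by \<omega> s n \<le> snd (run G \<theta> a \<omega> (events_by a s \<omega>)) n"
    unfolding r rings_by_def by (simp add: Least_le)
qed

lemma process_zero:
  assumes "good \<omega>"
  shows "spectrum_process G \<theta> a 0 \<omega> = a"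
proof -
  have "0 < event_time G \<theta> a \<omega> 0"
    using assms next_user_in[of \<omega> "\<lambda>_. 0"] by (simp add: event_time_def good_def Let_def)
  then have "events_by a 0 \<omega> = 0" by (intro events_by_eqI) auto
  then show ?thesis by (simp add: spectrum_process_eq)
qed

lemma process_right_continuous:
  assumes "good \<omega>"
  shows "eventually (\<lambda>s. spectrum_process G \<theta> a s \<omega> = spectrum_process G \<theta> a t \<omega>) (at_right t)"
proof -
  let ?e = "event_time G \<theta> a \<omega> (events_by a t \<omega>)"
  have "t < ?e" using events_by_gt good_unbounded[OF assms] by blast
  then have "eventually (\<lambda>s. s \<in> {t<..<?e}) (at_right t)" by (rule eventually_at_right_real)
  then show ?thesis
  proof eventually_elim
    case (elim s)
    then have "events_by a s \<omega> = events_by a t \<omega>"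
      using events_by_le[of _ a t \<omega>] by (intro events_by_eqI) fastforce+
    then show ?case by (simp add: spectrum_process_eq)
  qed
qed

section \<open>Paths driven by a glued sample\<close>

context
  fixes \<omega> \<omega>' :: "'c sample" and s :: real
  assumes \<omega>: "unbounded \<omega>" and \<omega>': "good \<omega>'" and s: "0 \<le> s"
begin

lemma glue_rows:
  assumes n: "n \<in> users G"
  shows glue_past: "j < rings_by \<omega> s n \<Longrightarrow> glue s \<omega> \<omega>' (n, j) = \<omega> (n, j)"
    and glue_ring_past: "j < rings_by \<omega> s n \<Longrightarrow> ring_time (glue s \<omega> \<omega>') n j = ring_time \<omega> n j"
    and glue_ring_future: "ring_time (glue s \<omega> \<omega>') n (rings_by \<omega> s n + k) = s + ring_time \<omega>' n k"
    and glue_mark_future: "snd (glue s \<omega> \<omega>' (n, rings_by \<omega> s n + k)) = snd (\<omega>' (n, k))"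
proof -
  note r = resample_past[of "rings_by \<omega> s n" "\<lambda>j. \<omega> (n, j)" s, folded ring_time_row, OF rings_by_le rings_by_gt[OF \<omega> n]]
  have g: "glue s \<omega> \<omega>' (n, j) = resample s (\<lambda>j. \<omega> (n, j)) (\<lambda>j. \<omega>' (n, j)) j" for j
    using glue_row[OF n, of s \<omega> \<omega>'] by (rule fun_cong)
  show past: "glue s \<omega> \<omega>' (n, j) = \<omega> (n, j)" if "j < rings_by \<omega> s n" for j
    unfolding g by (rule r(1)[OF _ that])
  show "j < rings_by \<omega> s n \<Longrightarrow> ring_time (glue s \<omega> \<omega>') n j = ring_time \<omega> n j"
    unfolding ring_time_def by (intro sum.cong) (auto simp: past)
  show "ring_time (glue s \<omega> \<omega>') n (rings_by \<omega> s n + k) = s + ring_time \<omega>' n k"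
    unfolding ring_time_row glue_row[OF n] by (rule r(2)[unfolded ring_time_row])
  show "snd (glue s \<omega> \<omega>' (n, rings_by \<omega> s n + k)) = snd (\<omega>' (n, k))"
    unfolding g by (rule r(3))
qed

text \<open>Gluing fixes the pending rings up to \<open>s\<close> and keeps the later ones after
  \<open>s\<close>, since a new first ring comes at \<open>s\<close> plus a positive time. As the
  minimum is at most \<open>s\<close>, the set of minimisers is unchanged, and with it the tie
  break.\<close>

lemma glue_next_user:
  assumes c: "\<And>m. m \<in> users G \<Longrightarrow> c m \<le> rings_by \<omega> s m"
    and le: "ring_time \<omega> (next_user G \<omega> c) (c (next_user G \<omega> c)) \<le> s"
  shows "next_user G (glue s \<omega> \<omega>') c = next_user G \<omega> c"
proof -
  let ?r = "\<lambda>m. ring_time \<omega> m (c m)" and ?r' = "\<lambda>m. ring_time (glue s \<omega> \<omega>') m (c m)"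
  let ?n = "next_user G \<omega> c"
  have n: "?n \<in> users G" by (rule next_user_in)
  have eq: "?r' m = ?r m" if "m \<in> users G" "?r m \<le> s" for m
  proof -
    have "c m < rings_by \<omega> s m"
      using c[OF that(1)] that(2) rings_by_gt[OF \<omega> that(1), of s] by (cases "c m = rings_by \<omega> s m") auto
    then show ?thesis by (rule glue_ring_past[OF that(1)])
  qed
  have gt: "s < ?r' m" if "m \<in> users G" "s < ?r m" for m
  proof -
    have "\<not> c m < rings_by \<omega> s m" using rings_by_le[of "c m" \<omega> s m] that by auto
    then have "c m = rings_by \<omega> s m + 0" using c[OF that(1)] by simp
    then have "?r' m = s + ring_time \<omega>' m 0" using glue_ring_future[OF that(1), of 0] by simp
    then show ?thesis using \<omega>' that(1) by (simp add: good_def)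
  qed
  have "(\<forall>m\<in>users G. ?r' k \<le> ?r' m) \<longleftrightarrow> (\<forall>m\<in>users G. ?r k \<le> ?r m)" if k: "k \<in> users G" for k
  proof
    assume *: "\<forall>m\<in>users G. ?r' k \<le> ?r' m"
    have "?r' k \<le> s" using *[rule_format, OF n] eq[OF n le] le by simp
    then have k': "?r k \<le> s" using gt[OF k] by (cases "?r k \<le> s") auto
    show "\<forall>m\<in>users G. ?r k \<le> ?r m"
    proof
      fix m assume m: "m \<in> users G"
      show "?r k \<le> ?r m"
        using *[rule_format, OF m] eq[OF k k'] eq[OF m] k' by (cases "?r m \<le> s") auto
    qed
  next
    assume *: "\<forall>m\<in>users G. ?r k \<le> ?r m"
    have k': "?r k \<le> s" using *[rule_format, OF n] le by simp
    show "\<forall>m\<in>users G. ?r' k \<le> ?r' m"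
    proof
      fix m assume m: "m \<in> users G"
      show "?r' k \<le> ?r' m"
        using *[rule_format, OF m] eq[OF k k'] eq[OF m] gt[OF m] k' by (cases "?r m \<le> s") auto
    qed
  qed
  then show ?thesis unfolding next_user_def by (metis (no_types, lifting))
qed

lemma glue_run_past:
  assumes "\<And>j. j < i \<Longrightarrow> event_time G \<theta> a \<omega> j \<le> s"
  shows "run G \<theta> a (glue s \<omega> \<omega>') i = run G \<theta> a \<omega> i"
    and "j < i \<Longrightarrow> event_time G \<theta> a (glue s \<omega> \<omega>') j = event_time G \<theta> a \<omega> j"
proof -
  have "run G \<theta> a (glue s \<omega> \<omega>') i = run G \<theta> a \<omega> i \<and>
      (\<forall>j<i. event_time G \<theta> a (glue s \<omega> \<omega>') j = event_time G \<theta> a \<omega> j)"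
    using assms
  proof (induction i)
    case (Suc i)
    obtain b c where r: "run G \<theta> a \<omega> i = (b, c)" by fastforce
    have r': "run G \<theta> a (glue s \<omega> \<omega>') i = (b, c)" using Suc r by simp
    let ?n = "next_user G \<omega> c"
    have n: "?n \<in> users G" by (rule next_user_in)
    have c: "c m \<le> rings_by \<omega> s m" if "m \<in> users G" for m
      using run_counts_le[OF \<omega> _ that, of i a s] Suc.prems r by simp
    have le: "ring_time \<omega> ?n (c ?n) \<le> s"
      using Suc.prems[of i] run_Suc(2)[OF r refl] by simp
    have n': "next_user G (glue s \<omega> \<omega>') c = ?n" using c le by (rule glue_next_user)
    have lt: "c ?n < rings_by \<omega> s ?n"
      using c[OF n] le rings_by_gt[OF \<omega> n, of s] by (cases "c ?n = rings_by \<omega> s ?n") auto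
    have "run G \<theta> a (glue s \<omega> \<omega>') (Suc i) = run G \<theta> a \<omega> (Suc i)"
      unfolding run_Suc(1)[OF r refl] run_Suc(1)[OF r' n'] glue_past[OF n lt] ..
    moreover have "event_time G \<theta> a (glue s \<omega> \<omega>') i = event_time G \<theta> a \<omega> i"
      unfolding run_Suc(2)[OF r refl] run_Suc(2)[OF r' n'] by (rule glue_ring_past[OF n lt])
    ultimately show ?case using Suc by (auto simp: less_Suc_eq)
  qed simp
  then show "run G \<theta> a (glue s \<omega> \<omega>') i = run G \<theta> a \<omega> i"
    and "j < i \<Longrightarrow> event_time G \<theta> a (glue s \<omega> \<omega>') j = event_time G \<theta> a \<omega> j" by auto
qed

text \<open>At time \<open>s\<close> the counter of every user points to its first resampled round.
  From there on the glued run reads the rounds of \<open>\<omega>'\<close>, with counters offset by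
  \<open>c\<close> and times offset by \<open>s\<close>.\<close>

lemma glue_run_future:
  assumes r0: "run G \<theta> a \<omega> (events_by a s \<omega>) = (b, c)"
  shows "run G \<theta> a (glue s \<omega> \<omega>') (events_by a s \<omega> + i)
      = (fst (run G \<theta> b \<omega>' i), \<lambda>n. c n + snd (run G \<theta> b \<omega>' i) n)"
    and "event_time G \<theta> a (glue s \<omega> \<omega>') (events_by a s \<omega> + i) = s + event_time G \<theta> b \<omega>' i"
proof -
  let ?g = "glue s \<omega> \<omega>'"
  have c: "c n = rings_by \<omega> s n" if "n \<in> users G" for n
    using run_counts_eq[OF \<omega> that, of a s] r0 by simp
  have ring: "ring_time ?g n (c n + k) = s + ring_time \<omega>' n k" if "n \<in> users G" for n k
    using glue_ring_future[OF that] c[OF that] by simp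
  \<comment> \<open>The offset \<open>s\<close> is common to all users and does not affect
    comparisons.\<close>
  have nxt: "next_user G ?g (\<lambda>n. c n + d n) = next_user G \<omega>' d" for d
    unfolding next_user_def by (rule arg_cong[where f=Least]) (auto simp: ring fun_eq_iff)
  have event: "event_time G \<theta> a ?g (events_by a s \<omega> + i) = s + event_time G \<theta> b \<omega>' i"
    if "run G \<theta> a ?g (events_by a s \<omega> + i) = (fst (run G \<theta> b \<omega>' i), \<lambda>n. c n + snd (run G \<theta> b \<omega>' i) n)" for i
    using next_user_in[of \<omega>' "snd (run G \<theta> b \<omega>' i)"]
    unfolding run_Suc(2)[OF that nxt] by (simp add: event_time_def Let_def ring)
  show run: "run G \<theta> a ?g (events_by a s \<omega> + i) = (fst (run G \<theta> b \<omega>' i), \<lambda>n. c n + snd (run G \<theta> b \<omega>' i) n)"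
  proof (induction i)
    case 0
    then show ?case using glue_run_past(1)[of "events_by a s \<omega>" a] events_by_le r0 by simp
  next
    case (Suc i)
    obtain b' d where r: "run G \<theta> b \<omega>' i = (b', d)" by fastforce
    let ?n = "next_user G \<omega>' d"
    have n: "?n \<in> users G" by (rule next_user_in)
    have r': "run G \<theta> a ?g (events_by a s \<omega> + i) = (b', \<lambda>n. c n + d n)" using Suc r by simp
    have mark: "snd (?g (?n, c ?n + d ?n)) = snd (\<omega>' (?n, d ?n))"
      using glue_mark_future[OF n] c[OF n] by simp
    have "run G \<theta> a ?g (Suc (events_by a s \<omega> + i))
        = (update_choice G \<theta> ?n (snd (\<omega>' (?n, d ?n))) b', (\<lambda>n. c n + d n)(?n := Suc (c ?n + d ?n)))"
      unfolding run_Suc(1)[OF r' nxt] mark ..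
    then show ?case using run_Suc(1)[OF r refl] by (auto simp: fun_eq_iff)
  qed
  show "event_time G \<theta> a ?g (events_by a s \<omega> + i) = s + event_time G \<theta> b \<omega>' i"
    by (rule event[OF run])
qed

text \<open>The pathwise form of the Markov property: numbers of events add up, and the past enters
  only through the state at time \<open>s\<close>.\<close>

lemma process_glue:
  assumes t: "0 \<le> t"
  shows "spectrum_process G \<theta> a (s + t) (glue s \<omega> \<omega>')
    = spectrum_process G \<theta> (spectrum_process G \<theta> a s \<omega>) t \<omega>'"
proof -
  obtain b c where r: "run G \<theta> a \<omega> (events_by a s \<omega>) = (b, c)" by fastforce
  note f = glue_run_future[OF r]
  have "events_by a (s + t) (glue s \<omega> \<omega>') = events_by a s \<omega> + events_by b t \<omega>'"
  proof (rule events_by_eqI)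
    show "s + t < event_time G \<theta> a (glue s \<omega> \<omega>') (events_by a s \<omega> + events_by b t \<omega>')"
      using events_by_gt[OF good_unbounded[OF \<omega>']] by (simp add: f)
    fix j assume j: "j < events_by a s \<omega> + events_by b t \<omega>'"
    show "event_time G \<theta> a (glue s \<omega> \<omega>') j \<le> s + t"
    proof (cases "j < events_by a s \<omega>")
      case True
      then show ?thesis
        using glue_run_past(2)[of "events_by a s \<omega>" a j] events_by_le[of _ a s \<omega>] t by fastforce
    next
      case False
      then obtain k where "j = events_by a s \<omega> + k" using le_Suc_ex[of "events_by a s \<omega>" j] by auto
      with j show ?thesis using events_by_le[of k b t \<omega>'] by (simp add: f)
    qed
  qed
  then show ?thesis using r by (simp add: spectrum_process_eq f)
qed

lemma process_glue_same: "spectrum_process G \<theta> a s (glue s \<omega> \<omega>') = spectrum_process G \<theta> a s \<omega>"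
  using process_glue[of 0 a] process_zero[OF \<omega>'] by simp

end

section \<open>Measurability of the process\<close>

lemma measurable_ring_time [measurable]:
  assumes "n \<in> users G"
  shows "(\<lambda>\<omega>. ring_time \<omega> n k) \<in> borel_measurable \<Omega>"
  unfolding ring_time_row by (rule C.measurable_row_time[OF measurable_row[OF assms measurable_ident_sets[OF refl]]])

lemma measurable_next_user: "(\<lambda>\<omega>. next_user G \<omega> c) \<in> measurable \<Omega> (count_space (users G))"
proof (rule measurable_count_space_mono)
  show "(\<lambda>\<omega>. next_user G \<omega> c) \<in> measurable \<Omega> (count_space UNIV)"
    unfolding next_user_def
  proof (rule measurable_Least)
    fix n
    show "Measurable.pred \<Omega> (\<lambda>\<omega>. n \<in> users G \<and> (\<forall>m\<in>users G. ring_time \<omega> n (c n) \<le> ring_time \<omega> m (c m)))"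
      by (cases "n \<in> users G")
        (auto simp: pred_def intro!: sets.sets_Collect_finite_All borel_measurable_le)
  qed
qed (rule next_user_in)

text \<open>Counters that vanish outside the users form a countable set, unlike all functions on the
  naturals. Countability allows a random counter to be treated value by value.\<close>

definition counts :: "(nat \<Rightarrow> nat) set" where
  "counts = {c. \<forall>n. n \<notin> users G \<longrightarrow> c n = 0}"

lemma countable_counts: "countable counts"
proof (rule countable_image_inj_on)
  show "countable ((\<lambda>c. restrict c (users G)) ` counts)"
    by (rule countable_subset[OF _ countable_PiE[of "users G" "\<lambda>_. UNIV :: nat set"]]) auto
  show "inj_on (\<lambda>c. restrict c (users G)) counts"
    by (auto simp: inj_on_def counts_def fun_eq_iff restrict_def) metis
qed

lemma measurable_update_choice:
  assumes n: "n \<in> users G" and b: "b \<in> profiles G"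
  shows "(\<lambda>m. update_choice G \<theta> n m b) \<in> measurable (marks n) (count_space (profiles G))"
proof -
  have ch: "fst \<in> measurable (marks n) (count_space (channels G n))"
  proof -
    have "measurable (marks n) (uniform_count_measure (menu n)) = measurable (marks n) (count_space (channels G n))"
      using n by (intro measurable_cong_sets) (simp_all add: sets_uniform_count_measure menu_def)
    then show ?thesis
      using measurable_fst[of "uniform_count_measure (menu n)" "uniform_measure lborel {0..1::real}"]
      unfolding marks_def by simp
  qed
  have u: "snd \<in> borel_measurable (marks n)"
    unfolding marks_def
    using measurable_snd[of "uniform_count_measure (menu n)" "uniform_measure lborel {0..1::real}"]
    by (simp cong: measurable_cong_sets)
  have "(\<lambda>m. if snd m \<le> move_prob G \<theta> n b (fst m) then b(n := fst m) else b)
      \<in> measurable (marks n) (count_space (profiles G))"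
  proof (rule measurable_compose_countable'[OF _ ch, where f="\<lambda>c m. if snd m \<le> move_prob G \<theta> n b c then b(n := c) else b"])
    fix c assume c: "c \<in> channels G n"
    show "(\<lambda>m. if snd m \<le> move_prob G \<theta> n b c then b(n := c) else b) \<in> measurable (marks n) (count_space (profiles G))"
      using u b profile_upd[OF b n c] by (intro measurable_If measurable_const) simp_all
  qed (use channels_finite[OF n] in \<open>simp add: countable_finite\<close>)
  then show ?thesis by (simp add: update_choice_def case_prod_beta)
qed

lemma measurable_update_choice_coord:
  assumes n: "n \<in> users G" and b: "b \<in> profiles G"
  shows "(\<lambda>\<omega>. update_choice G \<theta> n (snd (\<omega> (n, k))) b) \<in> measurable \<Omega> (count_space (profiles G))"
proof (rule measurable_compose[OF _ measurable_update_choice[OF n b]])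
  show "(\<lambda>\<omega>. snd (\<omega> (n, k))) \<in> measurable \<Omega> (marks n)"
    by (rule measurable_compose[OF measurable_coord[OF n measurable_ident_sets[OF refl], of k, unfolded C.E_def] measurable_snd])
qed

text \<open>Which coordinate of the sample is read next depends on the sample itself. The current
  state and the next user take countably many values, so it suffices to fix them and to check each
  case.\<close>

lemma measurable_run:
  assumes a: "a \<in> profiles G"
  shows "(\<lambda>\<omega>. run G \<theta> a \<omega> i) \<in> measurable \<Omega> (count_space (profiles G \<times> counts))"
proof (induction i)
  case 0
  then show ?case using a by (simp add: counts_def)
next
  case (Suc i)
  have step: "(\<lambda>\<omega>. (update_choice G \<theta> n (snd (\<omega> (n, c n))) b, c(n := Suc (c n))))
      \<in> measurable \<Omega> (count_space (profiles G \<times> counts))"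
    if n: "n \<in> users G" and bc: "b \<in> profiles G" "c \<in> counts" for n b c
  proof -
    have "(\<lambda>b. (b, c(n := Suc (c n)))) \<in> measurable (count_space (profiles G)) (count_space (profiles G \<times> counts))"
      using n bc by (simp add: counts_def)
    from measurable_compose[OF measurable_update_choice_coord[OF n bc(1), of "c n"] this] show ?thesis .
  qed
  have step': "(\<lambda>\<omega>. let n = next_user G \<omega> c in (update_choice G \<theta> n (snd (\<omega> (n, c n))) b, c(n := Suc (c n))))
      \<in> measurable \<Omega> (count_space (profiles G \<times> counts))"
    if bc: "b \<in> profiles G" "c \<in> counts" for b c
    unfolding Let_def
    by (rule measurable_compose_countable'[OF step[OF _ bc] measurable_next_user]) (auto simp: countable_finite)
  \<comment> \<open>Separates the two roles of the sample, as source of the current state and of the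
    next marks, so that the state can be fixed.\<close>
  define F where "F r \<omega> = (case r of (b, c) \<Rightarrow>
      let n = next_user G \<omega> c in (update_choice G \<theta> n (snd (\<omega> (n, c n))) b, c(n := Suc (c n))))"
    for r :: "(nat \<Rightarrow> 'c) \<times> (nat \<Rightarrow> nat)" and \<omega> :: "'c sample"
  have "(\<lambda>\<omega>. F (run G \<theta> a \<omega> i) \<omega>) \<in> measurable \<Omega> (count_space (profiles G \<times> counts))"
  proof (rule measurable_compose_countable'[OF _ Suc, where f=F])
    fix r assume "r \<in> profiles G \<times> counts"
    then obtain b c where "r = (b, c)" "b \<in> profiles G" "c \<in> counts" by auto
    have "(\<lambda>\<omega>. F r \<omega>) \<in> measurable \<Omega> (count_space (profiles G \<times> counts))"
      using step'[OF \<open>b \<in> profiles G\<close> \<open>c \<in> counts\<close>] \<open>r = (b, c)\<close>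
      unfolding F_def by (simp only: case_prod_conv)
    then show "F r \<in> measurable \<Omega> (count_space (profiles G \<times> counts))" .
  next
    show "countable (profiles G \<times> counts)"
      using countable_counts by (intro countable_SIGMA) (auto simp: countable_finite)
  qed
  then show ?case by (simp only: F_def run.simps Let_def case_prod_beta)
qed

lemma measurable_event_time:
  assumes a: "a \<in> profiles G"
  shows "(\<lambda>\<omega>. event_time G \<theta> a \<omega> i) \<in> borel_measurable \<Omega>"
proof -
  have "(\<lambda>\<omega>. ring_time \<omega> (next_user G \<omega> c) (c (next_user G \<omega> c))) \<in> borel_measurable \<Omega>" for c
    by (rule measurable_compose_countable'[OF _ measurable_next_user, where f="\<lambda>n \<omega>. ring_time \<omega> n (c n)"])
      (auto simp: countable_finite)
  then have "(\<lambda>\<omega>. (\<lambda>(b, c). ring_time \<omega> (next_user G \<omega> c) (c (next_user G \<omega> c))) (run G \<theta> a \<omega> i)) \<in> borel_measurable \<Omega>"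
    by (intro measurable_compose_countable'[OF _ measurable_run[OF a],
          where f="\<lambda>r \<omega>. (\<lambda>(b, c). ring_time \<omega> (next_user G \<omega> c) (c (next_user G \<omega> c))) r"])
      (use countable_counts in \<open>auto simp: countable_finite\<close>)
  then show ?thesis by (simp add: event_time_def Let_def case_prod_beta)
qed

lemma measurable_process [measurable]:
  assumes a: "a \<in> profiles G"
  shows "spectrum_process G \<theta> a t \<in> measurable \<Omega> (count_space (profiles G))"
proof -
  note [measurable] = measurable_event_time[OF a]
  have 1: "(\<lambda>\<omega>. LEAST i. t < event_time G \<theta> a \<omega> i) \<in> measurable \<Omega> (count_space UNIV)"
    by measurable
  have 2: "(\<lambda>\<omega>. fst (run G \<theta> a \<omega> i)) \<in> measurable \<Omega> (count_space (profiles G))" for i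
  proof -
    have "fst \<in> measurable (count_space (profiles G \<times> counts)) (count_space (profiles G))" by auto
    from measurable_compose[OF measurable_run[OF a] this] show ?thesis .
  qed
  have "(\<lambda>\<omega>. fst (run G \<theta> a \<omega> (LEAST i. t < event_time G \<theta> a \<omega> i))) \<in> measurable \<Omega> (count_space (profiles G))"
    by (rule measurable_compose_countable[OF 2 1])
  then show ?thesis unfolding spectrum_process_def .
qed

subsection \<open>The Markov property\<close>

abbreviation X :: "(nat \<Rightarrow> 'c) \<Rightarrow> real \<Rightarrow> 'c sample \<Rightarrow> nat \<Rightarrow> 'c" where
  "X \<equiv> spectrum_process G \<theta>"

abbreviation p :: "real \<Rightarrow> (nat \<Rightarrow> 'c) \<Rightarrow> (nat \<Rightarrow> 'c) \<Rightarrow> real" where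
  "p \<equiv> transition_prob G \<theta> \<tau>"

lemma pred_process [measurable]:
  assumes "a \<in> profiles G"
  shows "Measurable.pred \<Omega> (\<lambda>\<omega>. X a t \<omega> = b)"
proof (cases "b \<in> profiles G")
  case True
  have "{\<omega> \<in> space \<Omega>. X a t \<omega> = b} = X a t -` {b} \<inter> space \<Omega>" by auto
  also have "\<dots> \<in> sets \<Omega>"
    by (rule measurable_sets[OF measurable_process[OF assms]]) (use True in simp)
  finally show ?thesis by (simp add: pred_def)
next
  case False
  then have "{\<omega> \<in> space \<Omega>. X a t \<omega> = b} = {}"
    using measurable_space[OF measurable_process[OF assms, of t]] by auto
  then show ?thesis unfolding pred_def by (simp only: sets.empty_sets)
qed

text \<open>The sample may be replaced by a glued pair. Then the event at time \<open>s\<close>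
  depends on the first component and \<open>P\<close> on the second, up to null sets, and the
  product measure factorises.\<close>

lemma prob_split:
  assumes a: "a \<in> profiles G" and s: "0 \<le> s"
    and P [measurable]: "Measurable.pred \<Omega> P" and Q [measurable]: "Measurable.pred \<Omega> Q"
    and PQ: "\<And>\<omega> \<omega>'. \<lbrakk>good \<omega>; good \<omega>'; X a s \<omega> = b\<rbrakk> \<Longrightarrow> P (glue s \<omega> \<omega>') \<longleftrightarrow> Q \<omega>'"
  shows "\<Omega>.prob {\<omega>\<in>space \<Omega>. X a s \<omega> = b \<and> P \<omega>} = p s a b * \<Omega>.prob {\<omega>\<in>space \<Omega>. Q \<omega>}"
proof -
  interpret \<Omega>\<Omega>: pair_prob_space \<Omega> \<Omega> ..
  note [measurable] = pred_process[OF a]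
  have g [measurable]: "(\<lambda>z. glue s (fst z) (snd z)) \<in> measurable (\<Omega> \<Otimes>\<^sub>M \<Omega>) \<Omega>"
    using measurable_glue[of s] by (simp add: case_prod_beta)
  have gP: "Measurable.pred (\<Omega> \<Otimes>\<^sub>M \<Omega>) (\<lambda>z. X a s (glue s (fst z) (snd z)) = b \<and> P (glue s (fst z) (snd z)))"
    by measurable
  have "\<Omega>.prob {\<omega>\<in>space \<Omega>. X a s \<omega> = b \<and> P \<omega>}
      = measure (distr (\<Omega> \<Otimes>\<^sub>M \<Omega>) \<Omega> (\<lambda>z. glue s (fst z) (snd z))) {\<omega>\<in>space \<Omega>. X a s \<omega> = b \<and> P \<omega>}"
    unfolding distr_glue[OF s, unfolded case_prod_beta'] ..
  also have "\<dots> = \<Omega>\<Omega>.prob {z\<in>space (\<Omega> \<Otimes>\<^sub>M \<Omega>). X a s (glue s (fst z) (snd z)) = b \<and> P (glue s (fst z) (snd z))}"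
    by (subst measure_distr) (auto intro!: arg_cong[where f="\<Omega>\<Omega>.prob"] dest: measurable_space[OF g])
  also have "\<dots> = \<Omega>\<Omega>.prob {z\<in>space (\<Omega> \<Otimes>\<^sub>M \<Omega>). X a s (fst z) = b \<and> Q (snd z)}"
  proof (rule \<Omega>\<Omega>.prob_eq_AE)
    obtain N where N: "N \<in> null_sets \<Omega>" "{\<omega>\<in>space \<Omega>. \<not> good \<omega>} \<subseteq> N"
      using good_AE by (auto simp: eventually_ae_filter)
    have "AE z in \<Omega> \<Otimes>\<^sub>M \<Omega>. good (fst z)"
      by (rule AE_I'[OF \<Omega>.times_in_null_sets1[OF N(1) sets.top]]) (use N(2) in \<open>auto simp: space_pair_measure\<close>)
    moreover have "AE z in \<Omega> \<Otimes>\<^sub>M \<Omega>. good (snd z)"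
      by (rule AE_I'[OF \<Omega>.times_in_null_sets2[OF sets.top N(1)]]) (use N(2) in \<open>auto simp: space_pair_measure\<close>)
    ultimately show "AE z in \<Omega> \<Otimes>\<^sub>M \<Omega>. X a s (glue s (fst z) (snd z)) = b \<and> P (glue s (fst z) (snd z))
        \<longleftrightarrow> X a s (fst z) = b \<and> Q (snd z)"
    proof eventually_elim
      case (elim z)
      then show ?case
        using process_glue_same[OF good_unbounded[OF elim(1)] elim(2) s, of a] PQ[of "fst z" "snd z"] by auto
    qed
  qed (use gP in \<open>simp_all add: pred_def\<close>)
  also have "{z\<in>space (\<Omega> \<Otimes>\<^sub>M \<Omega>). X a s (fst z) = b \<and> Q (snd z)}
      = {\<omega>\<in>space \<Omega>. X a s \<omega> = b} \<times> {\<omega>\<in>space \<Omega>. Q \<omega>}"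
    by (auto simp: space_pair_measure)
  also have "\<Omega>\<Omega>.prob \<dots> = \<Omega>.prob {\<omega>\<in>space \<Omega>. X a s \<omega> = b} * \<Omega>.prob {\<omega>\<in>space \<Omega>. Q \<omega>}"
    by (simp add: measure_def \<Omega>.emeasure_pair_measure_Times enn2real_mult)
  finally show ?thesis by (simp add: transition_prob_def)
qed

text \<open>Splitting at the first observation leaves a path that starts in \<open>c 0\<close> and
  is observed at times shifted by \<open>s 0\<close>; hence the start and the times are general in
  the induction, and the time differences do not change.\<close>

lemma prob_path:
  assumes "a \<in> profiles G" "0 \<le> s 0" "\<And>i. i < k \<Longrightarrow> s i \<le> s (Suc i)" "\<And>i. i \<le> k \<Longrightarrow> c i \<in> profiles G"
  shows "\<Omega>.prob {\<omega>\<in>space \<Omega>. \<forall>i\<le>k. X a (s i) \<omega> = c i}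
    = p (s 0) a (c 0) * (\<Prod>i<k. p (s (Suc i) - s i) (c i) (c (Suc i)))"
  using assms
proof (induction k arbitrary: a s c)
  case 0
  then show ?case by (simp add: transition_prob_def)
next
  case (Suc k)
  have s_mono: "s 0 \<le> s (Suc i)" if "i \<le> k" for i
    using that
  proof (induction i)
    case 0
    then show ?case using Suc.prems(3)[of 0] by simp
  next
    case (Suc i)
    then show ?case using Suc.prems Suc.IH \<open>\<And>i. i < Suc k \<Longrightarrow> s i \<le> s (Suc i)\<close>[of "Suc i"] by simp
  qed
  have c0: "c 0 \<in> profiles G" using Suc.prems(4)[of 0] by simp
  note [measurable] = pred_process[OF Suc.prems(1)] pred_process[OF c0]
  have all_Suc: "(\<forall>i\<le>Suc k. R i) \<longleftrightarrow> R 0 \<and> (\<forall>i\<le>k. R (Suc i))" for R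
    using All_less_Suc2[of "Suc k" R] by (simp only: less_Suc_eq_le)
  have "\<Omega>.prob {\<omega>\<in>space \<Omega>. \<forall>i\<le>Suc k. X a (s i) \<omega> = c i}
      = \<Omega>.prob {\<omega>\<in>space \<Omega>. X a (s 0) \<omega> = c 0 \<and> (\<forall>i\<le>k. X a (s (Suc i)) \<omega> = c (Suc i))}"
    unfolding all_Suc ..
  also have "\<dots> = p (s 0) a (c 0) * \<Omega>.prob {\<omega>\<in>space \<Omega>. \<forall>i\<le>k. X (c 0) (s (Suc i) - s 0) \<omega> = c (Suc i)}"
  proof (rule prob_split[OF Suc.prems(1,2)])
    fix \<omega> \<omega>' assume "good \<omega>" "good \<omega>'" "X a (s 0) \<omega> = c 0"
    then have "X a (s (Suc i)) (glue (s 0) \<omega> \<omega>') = X (c 0) (s (Suc i) - s 0) \<omega>'" if "i \<le> k" for i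
      using process_glue[OF good_unbounded, of \<omega> \<omega>' "s 0" "s (Suc i) - s 0" a] s_mono[OF that] Suc.prems(2) by simp
    then show "(\<forall>i\<le>k. X a (s (Suc i)) (glue (s 0) \<omega> \<omega>') = c (Suc i)) \<longleftrightarrow> (\<forall>i\<le>k. X (c 0) (s (Suc i) - s 0) \<omega>' = c (Suc i))"
      by simp
  qed measurable
  also have "\<Omega>.prob {\<omega>\<in>space \<Omega>. \<forall>i\<le>k. X (c 0) (s (Suc i) - s 0) \<omega> = c (Suc i)}
      = p (s (Suc 0) - s 0) (c 0) (c (Suc 0)) *
        (\<Prod>i<k. p ((s (Suc (Suc i)) - s 0) - (s (Suc i) - s 0)) (c (Suc i)) (c (Suc (Suc i))))"
    by (rule Suc.IH) (use Suc.prems c0 s_mono in auto)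
  also have "\<dots> = (\<Prod>i<Suc k. p (s (Suc i) - s i) (c i) (c (Suc i)))"
    unfolding prod.lessThan_Suc_shift by simp
  finally show ?case .
qed

lemma prob_partition:
  assumes a: "a \<in> profiles G" and [measurable]: "Measurable.pred \<Omega> P"
  shows "\<Omega>.prob {\<omega>\<in>space \<Omega>. P \<omega>} = (\<Sum>b\<in>profiles G. \<Omega>.prob {\<omega>\<in>space \<Omega>. X a t \<omega> = b \<and> P \<omega>})"
proof (rule \<Omega>.prob_sum)
  note [measurable] = pred_process[OF a]
  show "{\<omega>\<in>space \<Omega>. P \<omega>} \<in> sets \<Omega>" by measurable
  show "{\<omega>\<in>space \<Omega>. X a t \<omega> = b \<and> P \<omega>} \<in> sets \<Omega>" for b by measurable
  show "AE \<omega> in \<Omega>. (\<forall>b\<in>profiles G. (X a t \<omega> = b \<and> P \<omega>) \<longrightarrow> P \<omega>) \<and> (P \<omega> \<longrightarrow> (\<exists>!b\<in>profiles G. X a t \<omega> = b \<and> P \<omega>))"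
    using measurable_space[OF measurable_process[OF a, of t]] by (intro AE_I2) auto
qed simp

lemma markov_process_spectrum:
  assumes a: "a \<in> profiles G"
  shows "markov_process \<Omega> (X a) (profiles G) p"
  unfolding markov_process_def
proof (intro conjI allI impI)
  show "prob_space \<Omega>" by (rule \<Omega>.prob_space_axioms)
  show "X a t \<in> measurable \<Omega> (count_space (profiles G))" for t
    by (rule measurable_process[OF a])
  show "AE \<omega> in \<Omega>. \<forall>t\<ge>0. eventually (\<lambda>s. X a s \<omega> = X a t \<omega>) (at_right t)"
    using good_AE by eventually_elim (simp add: process_right_continuous)
  fix k :: nat and s :: "nat \<Rightarrow> real" and c :: "nat \<Rightarrow> nat \<Rightarrow> 'c" and t b
  assume s0: "0 \<le> s 0" and s: "\<forall>i<k. s i \<le> s (Suc i)" and t: "s k \<le> t"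
    and c: "\<forall>i\<le>k. c i \<in> profiles G" and b: "b \<in> profiles G"
    and pos: "0 < \<P>(\<omega> in \<Omega>. \<forall>i\<le>k. X a (s i) \<omega> = c i)"
  \<comment> \<open>The pair of \<open>t\<close> and \<open>b\<close> becomes one more observation,
    so the conditional probability is a quotient of two path probabilities that differ by the last
    factor.\<close>
  define s' where "s' = s(Suc k := t)"
  define c' where "c' = c(Suc k := b)"
  have "{\<omega>\<in>space \<Omega>. X a t \<omega> = b \<and> (\<forall>i\<le>k. X a (s i) \<omega> = c i)} = {\<omega>\<in>space \<Omega>. \<forall>i\<le>Suc k. X a (s' i) \<omega> = c' i}"
    by (auto simp: s'_def c'_def le_Suc_eq)
  then have "\<Omega>.prob {\<omega>\<in>space \<Omega>. X a t \<omega> = b \<and> (\<forall>i\<le>k. X a (s i) \<omega> = c i)}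
      = \<Omega>.prob {\<omega>\<in>space \<Omega>. \<forall>i\<le>Suc k. X a (s' i) \<omega> = c' i}" by (rule arg_cong)
  also have "\<dots> = p (s' 0) a (c' 0) * (\<Prod>i<Suc k. p (s' (Suc i) - s' i) (c' i) (c' (Suc i)))"
    using s0 s t c b by (intro prob_path a) (auto simp: s'_def c'_def less_Suc_eq)
  also have "\<dots> = (p (s 0) a (c 0) * (\<Prod>i<k. p (s (Suc i) - s i) (c i) (c (Suc i)))) * p (t - s k) (c k) b"
    by (simp add: s'_def c'_def)
  also have "p (s 0) a (c 0) * (\<Prod>i<k. p (s (Suc i) - s i) (c i) (c (Suc i))) = \<P>(\<omega> in \<Omega>. \<forall>i\<le>k. X a (s i) \<omega> = c i)"
    using s0 s c by (intro prob_path[symmetric] a) auto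
  finally show "\<P>(\<omega> in \<Omega>. X a t \<omega> = b \<bar> \<forall>i\<le>k. X a (s i) \<omega> = c i) = p (t - s k) (c k) b"
    using pos by (simp add: cond_prob_def)
qed

lemma transition_prob_zero:
  assumes "a \<in> profiles G"
  shows "p 0 a b = of_bool (a = b)"
proof -
  note [measurable] = pred_process[OF assms]
  have "p 0 a b = \<Omega>.prob {\<omega>\<in>space \<Omega>. a = b}"
    unfolding transition_prob_def
  proof (rule \<Omega>.prob_eq_AE)
    show "AE \<omega> in \<Omega>. (X a 0 \<omega> = b) = (a = b)"
      using good_AE by eventually_elim (simp add: process_zero)
  qed measurable
  then show ?thesis by (simp add: \<Omega>.prob_space)
qed

lemma transition_prob_sum:
  assumes "a \<in> profiles G"
  shows "(\<Sum>b\<in>profiles G. p t a b) = 1"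
  using prob_partition[OF assms, of "\<lambda>_. True" t] by (simp add: transition_prob_def \<Omega>.prob_space)

text \<open>The Chapman-Kolmogorov equation, by splitting according to the state at time
  \<open>s\<close>.\<close>

lemma transition_prob_add:
  assumes a: "a \<in> profiles G" and s: "0 \<le> s" and t: "0 \<le> t"
  shows "p (s + t) a b = (\<Sum>c\<in>profiles G. p s a c * p t c b)"
proof -
  note [measurable] = pred_process[OF a]
  have "p (s + t) a b = (\<Sum>c\<in>profiles G. \<Omega>.prob {\<omega>\<in>space \<Omega>. X a s \<omega> = c \<and> X a (s + t) \<omega> = b})"
    unfolding transition_prob_def by (rule prob_partition[OF a]) measurable
  also have "\<dots> = (\<Sum>c\<in>profiles G. p s a c * p t c b)"
  proof (intro sum.cong refl)
    fix c assume c: "c \<in> profiles G"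
    show "\<Omega>.prob {\<omega>\<in>space \<Omega>. X a s \<omega> = c \<and> X a (s + t) \<omega> = b} = p s a c * p t c b"
      unfolding transition_prob_def[of G \<theta> \<tau> t]
      by (rule prob_split[OF a s]) (use c s t good_unbounded in \<open>auto simp: process_glue\<close>)
  qed
  finally show ?thesis .
qed

subsection \<open>Jump rates\<close>

lemma process_no_ring:
  assumes "\<And>n. n \<in> users G \<Longrightarrow> h < ring_time \<omega> n 0"
  shows "X a h \<omega> = a"
proof -
  have "h < event_time G \<theta> a \<omega> 0"
    using assms[OF next_user_in] by (simp add: event_time_def Let_def)
  then have "events_by a h \<omega> = 0" by (intro events_by_eqI) auto
  then show ?thesis by (simp add: spectrum_process_eq)
qed

lemma process_one_ring:
  assumes n: "n \<in> users G" and le: "ring_time \<omega> n 0 \<le> h" and gt: "h < ring_time \<omega> n 1"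
    and other: "\<And>m. m \<in> users G \<Longrightarrow> m \<noteq> n \<Longrightarrow> h < ring_time \<omega> m 0"
  shows "X a h \<omega> = update_choice G \<theta> n (snd (\<omega> (n, 0))) a"
proof -
  let ?c = "(\<lambda>_. 0 :: nat)(n := 1)"
  have "next_user G \<omega> (\<lambda>_. 0) = n"
    using next_user_le[OF n, of \<omega> "\<lambda>_. 0"] other[OF next_user_in, of \<omega> "\<lambda>_. 0"] le by fastforce
  note r = run_Suc[of a \<omega> 0 a "\<lambda>_. 0", OF _ this]
  have r1: "run G \<theta> a \<omega> 1 = (update_choice G \<theta> n (snd (\<omega> (n, 0))) a, ?c)" using r(1) by simp
  have e0: "event_time G \<theta> a \<omega> 0 = ring_time \<omega> n 0" using r(2) by simp
  have "h < event_time G \<theta> a \<omega> 1"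
    unfolding run_Suc(2)[OF r1 refl] using gt other[OF next_user_in, of \<omega> ?c] by auto
  then have "events_by a h \<omega> = 1" using e0 le by (intro events_by_eqI) auto
  then show ?thesis using r1 by (simp add: spectrum_process_eq)
qed

lemma prob_box:
  assumes "finite J" "J \<subseteq> users G \<times> UNIV" "\<And>k. k \<in> J \<Longrightarrow> A k \<in> sets (C.E (fst k))"
  shows "{\<omega>\<in>space \<Omega>. \<forall>k\<in>J. \<omega> k \<in> A k} \<in> sets \<Omega>"
    and "\<Omega>.prob {\<omega>\<in>space \<Omega>. \<forall>k\<in>J. \<omega> k \<in> A k} = (\<Prod>k\<in>J. measure (C.E (fst k)) (A k))"
proof -
  let ?M = "\<lambda>(n, j). C.E n" and ?I = "users G \<times> (UNIV :: nat set)"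
  have eq: "{\<omega>\<in>space \<Omega>. \<forall>k\<in>J. \<omega> k \<in> A k} = prod_emb ?I ?M J (Pi\<^sub>E J A)"
    unfolding \<Omega>_eq prod_emb_def space_PiM vimage_def restrict_PiE_iff by blast
  have A: "A k \<in> sets (?M k)" if "k \<in> J" for k using assms(3)[OF that] by (simp add: case_prod_beta)
  show "{\<omega>\<in>space \<Omega>. \<forall>k\<in>J. \<omega> k \<in> A k} \<in> sets \<Omega>"
    unfolding eq unfolding \<Omega>_eq using assms A by (intro sets_PiM_I) auto
  have "emeasure \<Omega> (prod_emb ?I ?M J (Pi\<^sub>E J A)) = (\<Prod>k\<in>J. emeasure (?M k) (A k))"
    unfolding \<Omega>_eq using assms A by (intro emeasure_PiM_emb) (auto simp: C.E.prob_space_axioms)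
  also have "\<dots> = (\<Prod>k\<in>J. ennreal (measure (C.E (fst k)) (A k)))"
    by (intro prod.cong refl) (simp add: case_prod_beta C.E.emeasure_eq_measure)
  also have "\<dots> = ennreal (\<Prod>k\<in>J. measure (C.E (fst k)) (A k))"
    by (intro prod_ennreal) simp
  finally show "\<Omega>.prob {\<omega>\<in>space \<Omega>. \<forall>k\<in>J. \<omega> k \<in> A k} = (\<Prod>k\<in>J. measure (C.E (fst k)) (A k))"
    unfolding eq by (simp add: measure_def prod_nonneg)
qed

definition total_rate :: real where
  "total_rate = (\<Sum>n\<in>users G. \<tau> n)"

definition waits :: "nat \<Rightarrow> real \<Rightarrow> (real \<times> 'c \<times> real) set" where
  "waits n h = {e\<in>space (C.E n). h < fst e}"

lemma measure_waits:
  assumes "n \<in> users G" "0 \<le> h"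
  shows "waits n h \<in> sets (C.E n)" "measure (C.E n) (waits n h) = exp (- \<tau> n * h)"
proof -
  show "waits n h \<in> sets (C.E n)"
    unfolding waits_def by (rule C.measure_wait_gt(1)[OF assms(2)])
  have "measure (C.E n) (waits n h) = exp (- rate n * h)"
    unfolding waits_def by (rule C.measure_wait_gt(2)[OF assms(2)])
  also have "exp (- rate n * h) = exp (- \<tau> n * h)" using assms(1) by (simp add: rate_def)
  finally show "measure (C.E n) (waits n h) = exp (- \<tau> n * h)" .
qed

definition no_ring :: "real \<Rightarrow> 'c sample set" where
  "no_ring h = {\<omega>\<in>space \<Omega>. \<forall>k\<in>users G \<times> {0}. \<omega> k \<in> waits (fst k) h}"

lemma no_ring:
  assumes "0 \<le> h"
  shows "no_ring h \<in> sets \<Omega>" "\<Omega>.prob (no_ring h) = exp (- total_rate * h)"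
proof -
  have J: "finite (users G \<times> {0::nat})" "users G \<times> {0} \<subseteq> users G \<times> (UNIV :: nat set)" by auto
  have W: "waits (fst k) h \<in> sets (C.E (fst k))" if "k \<in> users G \<times> {0}" for k
    using that assms by (auto intro: measure_waits)
  show "no_ring h \<in> sets \<Omega>" unfolding no_ring_def by (rule prob_box(1)[OF J W])
  have "\<Omega>.prob (no_ring h) = (\<Prod>k\<in>users G \<times> {0::nat}. measure (C.E (fst k)) (waits (fst k) h))"
    unfolding no_ring_def by (rule prob_box(2)[where A="\<lambda>k. waits (fst k) h", OF J W])
  also have "\<dots> = (\<Prod>k\<in>users G \<times> {0::nat}. exp (- \<tau> (fst k) * h))"
    using assms by (intro prod.cong refl measure_waits) auto
  also have "\<dots> = (\<Prod>n\<in>users G. exp (- \<tau> n * h))"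
    by (rule prod.reindex_bij_witness[of _ "\<lambda>n. (n, 0)" fst]) auto
  also have "\<dots> = exp (- total_rate * h)"
    by (simp add: exp_sum[symmetric] total_rate_def sum_negf sum_distrib_right)
  finally show "\<Omega>.prob (no_ring h) = exp (- total_rate * h)" .
qed

definition moves_to :: "nat \<Rightarrow> (nat \<Rightarrow> 'c) \<Rightarrow> (nat \<Rightarrow> 'c) \<Rightarrow> ('c \<times> real) set" where
  "moves_to n a b = {m\<in>space (marks n). update_choice G \<theta> n m a = b}"

text \<open>The transition matrix of a single ring of \<open>n\<close>. Its diagonal collects
  rejected moves and draws of the current channel, which makes the rows sum to 1.\<close>

definition kernel :: "nat \<Rightarrow> (nat \<Rightarrow> 'c) \<Rightarrow> (nat \<Rightarrow> 'c) \<Rightarrow> real" where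
  "kernel n a b = measure (marks n) (moves_to n a b)"

lemma sets_moves_to:
  assumes "n \<in> users G" "a \<in> profiles G" "b \<in> profiles G"
  shows "moves_to n a b \<in> sets (marks n)"
proof -
  have "moves_to n a b = (\<lambda>m. update_choice G \<theta> n m a) -` {b} \<inter> space (marks n)"
    by (auto simp: moves_to_def)
  also have "\<dots> \<in> sets (marks n)"
    by (rule measurable_sets[OF measurable_update_choice[OF assms(1,2)]]) (use assms(3) in simp)
  finally show ?thesis .
qed

lemma kernel_sum:
  assumes "n \<in> users G" "a \<in> profiles G"
  shows "(\<Sum>b\<in>profiles G. kernel n a b) = 1"
proof -
  have "measure (marks n) {m\<in>space (marks n). True} = (\<Sum>b\<in>profiles G. measure (marks n) {m\<in>space (marks n). update_choice G \<theta> n m a = b})"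
  proof (rule C.Q.prob_sum)
    show "AE m in marks n. (\<forall>b\<in>profiles G. update_choice G \<theta> n m a = b \<longrightarrow> True) \<and> (True \<longrightarrow> (\<exists>!b\<in>profiles G. update_choice G \<theta> n m a = b))"
      using measurable_space[OF measurable_update_choice[OF assms]] by (intro AE_I2) auto
  qed (use sets_moves_to[OF assms] in \<open>simp_all add: moves_to_def\<close>)
  then show ?thesis by (simp add: kernel_def moves_to_def C.Q.prob_space)
qed

lemma kernel_eq_0:
  assumes "\<And>c. b \<noteq> a(n := c)" "a \<noteq> b"
  shows "kernel n a b = 0"
proof -
  have "update_choice G \<theta> n m a \<noteq> b" for m
    using assms assms(1)[symmetric] by (cases m) (auto simp: update_choice_def)
  then have "moves_to n a b = {}" by (simp add: moves_to_def)
  then show ?thesis by (simp add: kernel_def)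
qed

lemma kernel_move:
  assumes n: "n \<in> users G" and c: "c \<in> channels G n" and ne: "a n \<noteq> c"
  shows "kernel n a (a(n := c)) = move_prob G \<theta> n a c / card (channels G n)"
proof -
  interpret U: prob_space "uniform_measure lborel {0..1::real}" by (rule prob_space_unit)
  let ?u = "move_prob G \<theta> n a c"
  have u: "0 \<le> ?u" "?u \<le> 1" using move_prob_pos[of \<theta> n a c] move_prob_le[of \<theta> n a c] by auto
  have ne': "a \<noteq> a(n := c)" "a(n := d) = a(n := c) \<longleftrightarrow> d = c" for d
    using ne by (auto simp: fun_eq_iff)
  have sp: "space (marks n) = channels G n \<times> UNIV"
    using n by (simp add: marks_def space_pair_measure space_uniform_count_measure menu_def)
  \<comment> \<open>The mark space contains all reals, so the acceptance event is a half-line; the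
    uniform law cuts it down to the part in the unit interval.\<close>
  have "moves_to n a (a(n := c)) = {c} \<times> {..?u}"
  proof (rule set_eqI)
    fix m :: "'c \<times> real"
    obtain d v where m: "m = (d, v)" by (cases m)
    show "m \<in> moves_to n a (a(n := c)) \<longleftrightarrow> m \<in> {c} \<times> {..?u}"
      unfolding m moves_to_def sp update_choice_def using c ne' by (cases "d = c") (simp_all del: fun_upd_apply)
  qed
  moreover have "emeasure (marks n) ({c} \<times> {..?u})
      = emeasure (uniform_count_measure (menu n)) {c} * emeasure (uniform_measure lborel {0..1}) {..?u}"
    unfolding marks_def using n c
    by (intro U.emeasure_pair_measure_Times) (auto simp: sets_uniform_count_measure menu_def)
  moreover have "measure (uniform_count_measure (menu n)) {c} = 1 / card (channels G n)"
    using n c by (subst measure_uniform_count_measure) (auto simp: menu_def channels_finite)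
  moreover have "measure (uniform_measure lborel {0..1}) {..?u} = ?u"
  proof -
    have "{0..1} \<inter> {..?u} = {0..?u}" using u by auto
    then show ?thesis using u by (subst measure_uniform_measure) auto
  qed
  ultimately show ?thesis
    by (simp add: kernel_def measure_def enn2real_mult)
qed

text \<open>A ring of \<open>n\<close> changes at most the entry of \<open>n\<close>. Hence for
  distinct profiles at most one user contributes to the sum, and none if they differ at several
  users.\<close>

lemma transition_rate_kernel:
  assumes a: "a \<in> profiles G" and b: "b \<in> profiles G" and ne: "a \<noteq> b"
  shows "transition_rate G \<theta> \<tau> a b = (\<Sum>n\<in>users G. \<tau> n * kernel n a b)"
proof (cases "\<exists>!n. n \<in> users G \<and> a n \<noteq> b n")
  case True
  then obtain n where n: "n \<in> users G" "a n \<noteq> b n" and uniq: "\<And>m. m \<in> users G \<Longrightarrow> a m \<noteq> b m \<Longrightarrow> m = n"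
    unfolding Ex1_def by blast
  have b_eq: "a(n := b n) = b"
    by (rule profiles_differ_eq[OF a b n(1) uniq, symmetric])
  have bn: "b n \<in> channels G n" using b n by (auto simp: profiles_def)
  have "kernel m a b = 0" if "m \<noteq> n" for m
    using that n ne by (intro kernel_eq_0) (auto simp: fun_eq_iff)
  then have "(\<Sum>m\<in>users G. \<tau> m * kernel m a b) = \<tau> n * kernel n a b"
    using n by (subst sum.remove[of _ n]) auto
  also have "\<dots> = \<tau> n / card (channels G n) * move_prob G \<theta> n a (b n)"
    using kernel_move[of n "b n" a, OF n(1) bn n(2)] by (simp add: b_eq)
  also have "\<dots> = transition_rate G \<theta> \<tau> a b"
    using transition_rate_single[of n a "b n" \<theta> \<tau>, OF n] by (simp add: b_eq)
  finally show ?thesis by simp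
next
  case False
  have "kernel n a b = 0" if n: "n \<in> users G" for n
  proof (rule kernel_eq_0[OF _ ne])
    fix c
    show "b \<noteq> a(n := c)"
    proof
      assume b_eq: "b = a(n := c)"
      from ne b_eq have "a n \<noteq> b n" by (metis fun_upd_same fun_upd_triv)
      moreover have "m = n" if "a m \<noteq> b m" for m using that b_eq by (cases "m = n") auto
      ultimately have "\<exists>!n. n \<in> users G \<and> a n \<noteq> b n" using n by blast
      with False show False ..
    qed
  qed
  then show ?thesis using False by (simp add: transition_rate_other)
qed

text \<open>The second wait of \<open>n\<close>, and not just its second ring, is required to exceed
  \<open>h\<close>. This loses only probability of order \<open>h\<close> squared and makes the
  event a box, whose probability is a product.\<close>

definition one_ring :: "nat \<Rightarrow> real \<Rightarrow> (nat \<Rightarrow> 'c) \<Rightarrow> (nat \<Rightarrow> 'c) \<Rightarrow> 'c sample set" where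
  "one_ring n h a b = {\<omega>\<in>space \<Omega>. \<forall>k\<in>insert (n, 1) (users G \<times> {0}). \<omega> k \<in>
     (if k = (n, 0) then {e\<in>space (C.E n). 0 \<le> fst e \<and> fst e \<le> h \<and> snd e \<in> moves_to n a b} else waits (fst k) h)}"

lemma one_ring:
  assumes h: "0 \<le> h" and n: "n \<in> users G" and a: "a \<in> profiles G" and b: "b \<in> profiles G"
  shows "one_ring n h a b \<in> sets \<Omega>"
    and "\<Omega>.prob (one_ring n h a b) = (1 - exp (- \<tau> n * h)) * exp (- total_rate * h) * kernel n a b"
proof -
  let ?J = "insert (n, 1) (users G \<times> {0::nat})"
  define B where "B = {e\<in>space (C.E n). 0 \<le> fst e \<and> fst e \<le> h \<and> snd e \<in> moves_to n a b}"
  let ?A = "\<lambda>k. if k = (n, 0) then B else waits (fst k) h"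
  have J: "finite ?J" "?J \<subseteq> users G \<times> UNIV" using n by auto
  have B: "B \<in> sets (C.E n)"
    unfolding B_def by (rule C.sets_wait_mark[OF h sets_moves_to[OF n a b]])
  have A: "?A k \<in> sets (C.E (fst k))" if "k \<in> ?J" for k
  proof (cases "k = (n, 0)")
    case True
    with B show ?thesis by simp
  next
    case False
    have "fst k \<in> users G" using that n by auto
    from measure_waits(1)[OF this h] False show ?thesis by simp
  qed
  let ?v = "\<lambda>k :: nat \<times> nat. if k = (n, 0) then (1 - exp (- \<tau> n * h)) * kernel n a b else exp (- \<tau> (fst k) * h)"
  have v: "measure (C.E (fst k)) (?A k) = ?v k" if "k \<in> ?J" for k
  proof (cases "k = (n, 0)")
    case True
    have "measure (C.E n) B = (1 - exp (- rate n * h)) * kernel n a b"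
      unfolding kernel_def B_def by (rule C.measure_wait_mark[OF h sets_moves_to[OF n a b]])
    also have "(1 - exp (- rate n * h)) * kernel n a b = (1 - exp (- \<tau> n * h)) * kernel n a b"
      using n by (simp add: rate_def)
    finally show ?thesis using True by simp
  next
    case False
    have "fst k \<in> users G" using that n by auto
    from measure_waits(2)[OF this h] False show ?thesis by simp
  qed
  show "one_ring n h a b \<in> sets \<Omega>" unfolding one_ring_def B_def[symmetric] by (rule prob_box(1)[OF J A])
  have "\<Omega>.prob (one_ring n h a b) = (\<Prod>k\<in>?J. measure (C.E (fst k)) (?A k))"
    unfolding one_ring_def B_def[symmetric] by (rule prob_box(2)[OF J A])
  also have "\<dots> = (\<Prod>k\<in>?J. ?v k)"
    by (intro prod.cong refl v)
  also have "?J = insert (n, 1) (insert (n, 0) ((users G - {n}) \<times> {0}))" using n by auto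
  also have "prod ?v \<dots> = exp (- \<tau> n * h) * ((1 - exp (- \<tau> n * h)) * kernel n a b * prod ?v ((users G - {n}) \<times> {0}))"
    by (subst prod.insert; simp)
  also have "prod ?v ((users G - {n}) \<times> {0}) = (\<Prod>m\<in>users G - {n}. exp (- \<tau> m * h))"
    by (rule prod.reindex_bij_witness[of _ "\<lambda>n. (n, 0)" fst]) auto
  also have "exp (- \<tau> n * h) * ((1 - exp (- \<tau> n * h)) * kernel n a b * (\<Prod>m\<in>users G - {n}. exp (- \<tau> m * h)))
      = (1 - exp (- \<tau> n * h)) * (exp (- \<tau> n * h) * (\<Prod>m\<in>users G - {n}. exp (- \<tau> m * h))) * kernel n a b"
    by (simp add: mult_ac)
  \<comment> \<open>The factor of the second wait of \<open>n\<close> fills the gap left by its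
    first wait, which completes the product over all users.\<close>
  also have "exp (- \<tau> n * h) * (\<Prod>m\<in>users G - {n}. exp (- \<tau> m * h)) = (\<Prod>m\<in>users G. exp (- \<tau> m * h))"
    using n by (intro prod.remove[symmetric]) auto
  also have "\<dots> = exp (- total_rate * h)"
    by (simp add: exp_sum[symmetric] total_rate_def sum_negf sum_distrib_right)
  finally show "\<Omega>.prob (one_ring n h a b) = (1 - exp (- \<tau> n * h)) * exp (- total_rate * h) * kernel n a b" .
qed

lemma one_ring_process:
  assumes "\<omega> \<in> one_ring n h a b" "n \<in> users G"
  shows "X a h \<omega> = b"
proof -
  have \<omega>: "\<omega> (n, 0) \<in> {e\<in>space (C.E n). 0 \<le> fst e \<and> fst e \<le> h \<and> snd e \<in> moves_to n a b}"
    "\<omega> (n, 1) \<in> waits n h" "\<And>m. m \<in> users G \<Longrightarrow> m \<noteq> n \<Longrightarrow> \<omega> (m, 0) \<in> waits m h"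
    using assms unfolding one_ring_def by auto
  have "X a h \<omega> = update_choice G \<theta> n (snd (\<omega> (n, 0))) a"
    using assms(2) \<omega> by (intro process_one_ring) (auto simp: ring_time_def waits_def)
  then show ?thesis using \<omega>(1) by (simp add: moves_to_def)
qed

text \<open>The probability of being in \<open>b\<close> at time \<open>h\<close> through
  \<open>no_ring\<close> or one of the events \<open>one_ring\<close>.\<close>

definition short_prob :: "real \<Rightarrow> (nat \<Rightarrow> 'c) \<Rightarrow> (nat \<Rightarrow> 'c) \<Rightarrow> real" where
  "short_prob h a b = of_bool (a = b) * exp (- total_rate * h)
     + (\<Sum>n\<in>users G. (1 - exp (- \<tau> n * h)) * exp (- total_rate * h) * kernel n a b)"

lemma short_prob_le:
  assumes h: "0 \<le> h" and a: "a \<in> profiles G" and b: "b \<in> profiles G"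
  shows "short_prob h a b \<le> p h a b"
proof -
  note [measurable] = pred_process[OF a]
  define F where "F = (if a = b then no_ring h else {})"
  have F: "F \<in> sets \<Omega>" "\<Omega>.prob F = of_bool (a = b) * exp (- total_rate * h)"
    using no_ring[OF h] by (simp_all add: F_def)
  \<comment> \<open>The user who rings first is determined by the sample, so the events are disjoint
    for different users; none of them meets \<open>no_ring\<close>.\<close>
  have rings: "\<omega> \<in> one_ring n h a b \<Longrightarrow> m \<in> users G \<Longrightarrow> fst (\<omega> (m, 0)) \<le> h \<longleftrightarrow> m = n" for \<omega> m n
    by (auto simp: one_ring_def waits_def split: if_splits)
  have "disjoint_family_on (\<lambda>n. one_ring n h a b) (users G)"
    unfolding disjoint_family_on_def using rings by blast
  then have O: "\<Omega>.prob (\<Union>n\<in>users G. one_ring n h a b) = (\<Sum>n\<in>users G. \<Omega>.prob (one_ring n h a b))"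
    using one_ring(1)[OF h _ a b] by (intro \<Omega>.finite_measure_finite_Union) auto
  have "F \<inter> (\<Union>n\<in>users G. one_ring n h a b) = {}"
    using rings by (force simp: F_def no_ring_def waits_def)
  then have "short_prob h a b = \<Omega>.prob (F \<union> (\<Union>n\<in>users G. one_ring n h a b))"
    using F O one_ring[OF h _ a b] by (subst \<Omega>.finite_measure_Union) (auto simp: short_prob_def)
  also have "\<dots> \<le> p h a b"
    unfolding transition_prob_def
  proof (rule \<Omega>.finite_measure_mono)
    show "F \<union> (\<Union>n\<in>users G. one_ring n h a b) \<subseteq> {\<omega>\<in>space \<Omega>. X a h \<omega> = b}"
    proof
      fix \<omega> assume \<omega>: "\<omega> \<in> F \<union> (\<Union>n\<in>users G. one_ring n h a b)"
      have "X a h \<omega> = b"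
      proof (cases "\<omega> \<in> F")
        case True
        then show ?thesis
          using process_no_ring[of h \<omega> a] by (auto simp: F_def no_ring_def waits_def ring_time_def split: if_splits)
      next
        case False
        with \<omega> show ?thesis by (auto intro: one_ring_process)
      qed
      moreover have "\<omega> \<in> space \<Omega>"
        using \<omega> by (auto simp: F_def no_ring_def one_ring_def split: if_splits)
      ultimately show "\<omega> \<in> {\<omega>\<in>space \<Omega>. X a h \<omega> = b}" by simp
    qed
  qed measurable
  finally show ?thesis .
qed

lemma short_prob_sum:
  assumes "a \<in> profiles G"
  shows "(\<Sum>b\<in>profiles G. short_prob h a b)
    = exp (- total_rate * h) + (\<Sum>n\<in>users G. (1 - exp (- \<tau> n * h)) * exp (- total_rate * h))"
proof -
  have "(\<Sum>b\<in>profiles G. \<Sum>n\<in>users G. (1 - exp (- \<tau> n * h)) * exp (- total_rate * h) * kernel n a b)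
      = (\<Sum>n\<in>users G. (1 - exp (- \<tau> n * h)) * exp (- total_rate * h) * (\<Sum>b\<in>profiles G. kernel n a b))"
    by (subst sum.swap) (simp add: sum_distrib_left)
  also have "\<dots> = (\<Sum>n\<in>users G. (1 - exp (- \<tau> n * h)) * exp (- total_rate * h))"
    using kernel_sum[OF _ assms] by simp
  moreover have "(\<Sum>b\<in>profiles G. of_bool (a = b) * exp (- total_rate * h)) = exp (- total_rate * h)"
    using assms by (simp add: sum_distrib_right[symmetric])
  ultimately show ?thesis by (simp add: short_prob_def sum.distrib)
qed

text \<open>Rows of \<open>p\<close> sum to 1 and dominate those of \<open>short_prob\<close>, so a
  single entry exceeds its lower bound by at most the mass that the whole row of
  \<open>short_prob\<close> lacks. This deficit is of smaller order than \<open>h\<close>, and the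
  entry is squeezed.\<close>

lemma jump_rates: "has_jump_rates (profiles G) p (transition_rate G \<theta> \<tau>)"
  unfolding has_jump_rates_def
proof (intro ballI impI)
  fix a b assume a: "a \<in> profiles G" and b: "b \<in> profiles G" and ne: "a \<noteq> b"
  have lim: "((\<lambda>h. (1 - exp (- t * h)) * exp (- u * h) / h) \<longlongrightarrow> t) (at_right 0)" for t u :: real
    by real_asymp
  have lim': "((\<lambda>h. (1 - exp (- u * h)) / h) \<longlongrightarrow> u) (at_right 0)" for u :: real
    by real_asymp
  have "((\<lambda>h. \<Sum>n\<in>users G. (1 - exp (- \<tau> n * h)) * exp (- total_rate * h) / h * kernel n a b)
      \<longlongrightarrow> (\<Sum>n\<in>users G. \<tau> n * kernel n a b)) (at_right 0)"
    by (intro tendsto_sum tendsto_mult tendsto_const lim)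
  then have low: "((\<lambda>h. short_prob h a b / h) \<longlongrightarrow> transition_rate G \<theta> \<tau> a b) (at_right 0)"
    using ne by (simp add: transition_rate_kernel[OF a b ne] short_prob_def sum_divide_distrib)
  \<comment> \<open>The deficit divided by \<open>h\<close>: the rate of leaving
    \<open>no_ring\<close> minus the rates of entering the events \<open>one_ring\<close>, which
    cancel in the limit.\<close>
  have "((\<lambda>h. (1 - exp (- total_rate * h)) / h - (\<Sum>n\<in>users G. (1 - exp (- \<tau> n * h)) * exp (- total_rate * h) / h))
      \<longlongrightarrow> total_rate - (\<Sum>n\<in>users G. \<tau> n)) (at_right 0)"
    by (intro tendsto_diff tendsto_sum lim lim')
  then have "((\<lambda>h. (1 - (\<Sum>b\<in>profiles G. short_prob h a b)) / h) \<longlongrightarrow> 0) (at_right 0)"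
    by (simp add: short_prob_sum[OF a] total_rate_def sum_divide_distrib diff_divide_distrib add_divide_distrib
        algebra_simps)
  from tendsto_add[OF low this]
  have up: "((\<lambda>h. short_prob h a b / h + (1 - (\<Sum>b\<in>profiles G. short_prob h a b)) / h)
      \<longlongrightarrow> transition_rate G \<theta> \<tau> a b) (at_right 0)" by simp
  show "((\<lambda>h. p h a b / h) \<longlongrightarrow> transition_rate G \<theta> \<tau> a b) (at_right 0)"
  proof (rule tendsto_sandwich[OF _ _ low up])
    show "\<forall>\<^sub>F h in at_right 0. short_prob h a b / h \<le> p h a b / h"
      using eventually_at_right_less[of "0::real"]
      by eventually_elim (use short_prob_le[OF _ a b] in \<open>simp add: divide_right_mono\<close>)
    show "\<forall>\<^sub>F h in at_right 0. p h a b / h \<le> short_prob h a b / h + (1 - (\<Sum>b\<in>profiles G. short_prob h a b)) / h"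
      using eventually_at_right_less[of "0::real"]
    proof eventually_elim
      case (elim h)
      have "(\<Sum>c\<in>profiles G - {b}. short_prob h a c) \<le> (\<Sum>c\<in>profiles G - {b}. p h a c)"
        using elim by (intro sum_mono short_prob_le a) auto
      moreover have "(\<Sum>c\<in>profiles G. short_prob h a c) = short_prob h a b + (\<Sum>c\<in>profiles G - {b}. short_prob h a c)"
        using b by (intro sum.remove) auto
      moreover have "1 = p h a b + (\<Sum>c\<in>profiles G - {b}. p h a c)"
        unfolding transition_prob_sum[OF a, of h, symmetric] using b by (intro sum.remove) auto
      ultimately have "p h a b \<le> short_prob h a b + (1 - (\<Sum>b\<in>profiles G. short_prob h a b))" by linarith
      then have "p h a b / h \<le> (short_prob h a b + (1 - (\<Sum>b\<in>profiles G. short_prob h a b))) / h"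
        using elim by (intro divide_right_mono) auto
      then show ?case by (simp only: add_divide_distrib)
    qed
  qed
qed

section \<open>Stationary distributions of the algorithm\<close>

sublocale semigroup: finite_semigroup "profiles G" p "transition_rate G \<theta> \<tau>"
  by (rule finite_semigroup.intro)
    (simp_all add: transition_prob_sum transition_prob_zero transition_prob_add jump_rates,
     simp add: transition_prob_def)

lemma gibbs_stationary: "stationary_distribution (profiles G) p (gibbs G \<theta>)"
  using gibbs_pos gibbs_sum
  by (intro semigroup.detailed_balance_imp_stationary gibbs_detailed_balance) (auto intro: less_imp_le)

text \<open>Distributions on profiles are represented by functions on the whole type, so uniqueness
  is agreement on \<open>profiles G\<close>.\<close>

lemma stationary_iff_gibbs:
  "stationary_distribution (profiles G) p \<pi> \<longleftrightarrow> (\<forall>a\<in>profiles G. \<pi> a = gibbs G \<theta> a)"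
proof
  assume "stationary_distribution (profiles G) p \<pi>"
  then show "\<forall>a\<in>profiles G. \<pi> a = gibbs G \<theta> a"
    using gibbs_pos gibbs_sum transition_rate_nonneg[OF \<tau>_pos] transition_rate_irreducible[OF \<tau>_pos]
    by (intro ballI semigroup.stationary_unique[OF gibbs_detailed_balance]) auto
next
  assume "\<forall>a\<in>profiles G. \<pi> a = gibbs G \<theta> a"
  then show "stationary_distribution (profiles G) p \<pi>"
    using gibbs_stationary unfolding stationary_distribution_def by simp
qed

end

theorem theorem2:
  fixes G :: "'c network" and \<theta> :: real and \<tau> :: "nat \<Rightarrow> real"
  assumes "spectrum_network G"
    and "\<theta> > 0"
    and "\<And>n. n \<in> users G \<Longrightarrow> \<tau> n > 0"
  shows "(\<forall>a\<in>profiles G.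
            (AE \<omega> in algorithm_space G \<tau>. spectrum_process G \<theta> a 0 \<omega> = a) \<and>
            ctmc (algorithm_space G \<tau>) (spectrum_process G \<theta> a) (profiles G)
              (transition_prob G \<theta> \<tau>) (transition_rate G \<theta> \<tau>)) \<and>
         time_reversible (profiles G) (transition_prob G \<theta> \<tau>) (transition_rate G \<theta> \<tau>) \<and>
         (\<forall>\<pi>. stationary_distribution (profiles G) (transition_prob G \<theta> \<tau>) \<pi> \<longleftrightarrow>
              (\<forall>a\<in>profiles G. \<pi> a = gibbs G \<theta> a))"
proof -
  interpret spectrum_network G by (rule assms(1))
  interpret spectrum_algorithm G \<theta> \<tau> by unfold_locales (use assms(3) in auto)
  have "AE \<omega> in \<Omega>. X a 0 \<omega> = a" for a
    using good_AE by eventually_elim (rule process_zero)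
  moreover have "ctmc \<Omega> (X a) (profiles G) p (transition_rate G \<theta> \<tau>)" if "a \<in> profiles G" for a
    using markov_process_spectrum[OF that] jump_rates by (simp add: ctmc_def)
  moreover have "time_reversible (profiles G) p (transition_rate G \<theta> \<tau>)"
    unfolding time_reversible_def using gibbs_stationary gibbs_detailed_balance by blast
  ultimately show ?thesis using stationary_iff_gibbs by blast
qed

end
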